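(* Let $k\geq 2$ and $q\geq 1$ be integers and let $\mathcal{A}=\{\boldsymbol{\alpha}_1,\dots,\boldsymbol{\alpha}_q\}$ be as in the context. For the type-$\mathcal{A}$ random walk on $\mathbb{Z}^k$, let $\overline{S}_{n,k}=\frac{1}{n}(X_1+\cdots+X_n)$. Then $$\lim_{n\to\infty}\overline{S}_{n,k}=\frac{1}{\zeta(k)}$$ almost surely, where $\zeta$ is the Riemann zeta function.
   Context: $\mathcal{A}=\{\boldsymbol{\alpha}_1,\dots,\boldsymbol{\alpha}_q\}$ is a finite set of vectors $\boldsymbol{\alpha}_t=(\alpha_{t,1},\dots,\alpha_{t,k})$ with $0<\alpha_{t,j}<1$ for all $j$ and $\alpha_{t,1}+\cdots+\alpha_{t,k}=1$. For $\boldsymbol{\alpha}=(\alpha_1,\dots,\alpha_k)$ of this form, a type-$\boldsymbol{\alpha}$ step $\mathbf{w}(\boldsymbol{\alpha})$ is a random vector equal to the $j$-th standard basis vector of $\mathbb{Z}^k$ with probability $\alpha_j$ ($1\le j\le k$). The type-$\mathcal{A}$ random walk is $\mathbf{p}_0=(0,\dots,0)$, $\mathbf{p}_i=\mathbf{p}_{i-1}+\mathbf{w}(\boldsymbol{\alpha}'_i)$ for $i\ge1$, where at each step a type $\boldsymbol{\alpha}'_i\in\mathcal{A}$ is chosen and the steps are independent. A lattice point $\mathbf{n}=(n_1,\dots,n_k)\in\mathbb{Z}^k$ is visible if there is no other lattice point on the straight segment joining it to the origin (equivalently $\gcd(n_1,\dots,n_k)=1$). $X_i=1$ if $\mathbf{p}_i$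 is visible and $X_i=0$ otherwise. *)

theory Defs
  imports "HOL-Probability.Probability"
begin

definition zeta_nat :: "nat \<Rightarrow> real" where
  "zeta_nat s = (\<Sum>n. 1 / real (Suc n) ^ s)"

definition visible :: "nat \<Rightarrow> (nat \<Rightarrow> int) \<Rightarrow> bool" where
  "visible k v \<longleftrightarrow> Gcd (v ` {..<k}) = 1"

text \<open>Position p_n of the walk: step i (i \<ge> 1) adds the standard basis vector e_{W i},
  so coordinate j of p_n counts the steps i in 1..n with W i = j.\<close>
definition walk_pos :: "(nat \<Rightarrow> 'a \<Rightarrow> nat) \<Rightarrow> nat \<Rightarrow> 'a \<Rightarrow> nat \<Rightarrow> int" where
  "walk_pos W n \<omega> = (\<lambda>j. int (card {i \<in> {1..n}. W i \<omega> = j}))"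

definition visX :: "nat \<Rightarrow> (nat \<Rightarrow> 'a \<Rightarrow> nat) \<Rightarrow> nat \<Rightarrow> 'a \<Rightarrow> real" where
  "visX k W i \<omega> = (if visible k (walk_pos W i \<omega>) then 1 else 0)"

end

theory Submission
  imports Defs
begin

text \<open>
  Fix a modulus \<open>d\<close> and let \<open>A\<^sub>d(n)\<close> be the fraction of the first \<open>n\<close> positions all of whose
  coordinates are divisible by \<open>d\<close>. Expanding the divisibility indicator in the characters of
  \<open>(\<int>/d)\<^sup>k\<close>, a character that is not constant across the coordinates contributes correlations
  that decay geometrically with ratio \<open>1 - \<Omega>(\<delta>\<^sup>2/d\<^sup>2)\<close>, where \<open>\<delta>\<close> is the smallest step probability; a
  constant one is a deterministic geometric sum because the coordinates add up to the time. This
  bounds the mean of \<open>\<bar>A\<^sub>d(n) - d\<^sup>-\<^sup>k\<bar>\<close> by \<open>O(d/\<surd>n)\<close>. For large \<open>d\<close> it is enough to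
  use that \<open>d\<close> divides both the time \<open>i\<close> and the first coordinate, the latter having probability
  at most \<open>1/d + O(log d/\<surd>i)\<close>.

  Along \<open>n = m\<^sup>3\<^sup>2\<close>, using the first bound for \<open>d \<le> m\<^sup>4\<close> and the second one above, the total error
  \<open>\<Sum>\<bar>A\<^sub>d(n) - d\<^sup>-\<^sup>k\<bar>\<close> has mean \<open>O(m\<^sup>-\<^sup>2)\<close> and hence vanishes almost surely. Sieving
  by the primes up to \<open>D\<close> and letting \<open>D\<close> grow turns this into the density of visible points, by
  the Euler product. Averages of a bounded sequence along \<open>m\<^sup>3\<^sup>2\<close> control all averages
  because \<open>(m+1)\<^sup>3\<^sup>2/m\<^sup>3\<^sup>2\<close> tends to 1.
\<close>

section \<open>Roots of unity and contraction of characters\<close>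

text \<open>The Taylor bound \<open>sin x >= x - x^3 / 6\<close> suffices, because
  \<open>pi / 2 < 8 / 5\<close> gives \<open>x^2 <= 3\<close> on this range.\<close>

lemma half_le_sin:
  fixes x :: real
  assumes "0 \<le> x" "x \<le> pi / 2"
  shows "x / 2 \<le> sin x"
proof -
  have "\<bar>sin x - (\<Sum>m<3. sin_coeff m * x ^ m)\<bar> \<le> inverse (fact 3) * \<bar>x\<bar> ^ 3"
    by (rule Maclaurin_sin_bound)
  moreover have "(\<Sum>m<3. sin_coeff m * x ^ m) = x"
    by (simp add: sin_coeff_def numeral_3_eq_3)
  moreover have "inverse (fact 3) * \<bar>x\<bar> ^ 3 = x ^ 3 / 6"
    using assms by (simp add: fact_numeral)
  ultimately have 1: "sin x \<ge> x - x ^ 3 / 6"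
    by linarith
  have "pi < 16 / 5" using pi_approx by simp
  then have "x ^ 2 \<le> (8 / 5) ^ 2" using assms by (intro power_mono) auto
  then have "x * x ^ 2 \<le> x * 3" using assms by (intro mult_left_mono) (auto simp: power2_eq_square)
  then have "x ^ 3 \<le> x * 3" by (simp add: power3_eq_cube power2_eq_square)
  with 1 show ?thesis by simp
qed

definition unity_root :: "nat \<Rightarrow> nat \<Rightarrow> complex" where
  "unity_root d h = cis (2 * pi * real h / real d)"

lemma norm_unity_root [simp]: "norm (unity_root d h) = 1"
  by (simp add: unity_root_def)

lemma unity_root_power: "unity_root d h ^ v = unity_root d (h * v)"
  by (simp add: unity_root_def Complex.DeMoivre field_simps)

lemma unity_root_eq_exp:
  "unity_root d h = exp (2 * of_real pi * \<i> * of_nat h / of_nat d)"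
  by (simp add: unity_root_def cis_conv_exp field_simps)

text \<open>Orthogonality of characters: exchanging the roles of \<open>h\<close> and
  \<open>v\<close> turns the sum into a geometric series whose ratio is a \<open>d\<close>-th root
  of unity, equal to 1 exactly when \<open>d\<close> divides \<open>v\<close>.\<close>

lemma sum_unity_root_power:
  assumes "d > 0"
  shows "(\<Sum>h<d. unity_root d h ^ v) = (if d dvd v then of_nat d else 0)"
proof -
  have eq: "unity_root d h ^ v = unity_root d v ^ h" for h
    by (simp add: unity_root_power mult.commute)
  have one: "unity_root d v = 1 \<longleftrightarrow> d dvd v"
    using assms by (simp add: unity_root_eq_exp complex_root_unity_eq_1)
  have "unity_root d v ^ d = 1"
    using assms by (simp add: unity_root_eq_exp complex_root_unity)
  then show ?thesis
    using one by (auto simp: eq sum_gp_strict)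
qed

text \<open>The chord has length \<open>2 * sin x\<close> with \<open>x = pi * h / d\<close>. Past
  \<open>pi / 2\<close> the reflection \<open>x\<close> to \<open>pi - x\<close> replaces
  \<open>h\<close> by \<open>d - h\<close>, which is where the minimum comes from.\<close>

lemma norm_unity_root_minus_one:
  assumes "0 < h" "h < d"
  shows "norm (unity_root d h - 1) \<ge> min (real h) (real (d - h)) / real d"
proof -
  define x where "x = pi * real h / real d"
  have x: "0 \<le> x" "x \<le> pi" using assms by (auto simp: x_def field_simps)
  have "unity_root d h = exp (\<i> * of_real (2 * x))"
    by (simp add: unity_root_def cis_conv_exp x_def mult_ac)
  then have eq: "norm (unity_root d h - 1) = 2 * sin x"
    using dist_exp_i_1[of "2 * x"] sin_ge_zero[OF x] by simp
  have big: "y / real d \<le> pi * y / real d" if "y \<ge> 0" for y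
  proof -
    have "1 * y \<le> pi * y" using pi_gt3 that by (intro mult_right_mono) auto
    then show ?thesis by (simp add: divide_right_mono)
  qed
  show ?thesis
  proof (cases "x \<le> pi / 2")
    case True
    have "real h / real d \<le> x" using big[of "real h"] by (simp add: x_def)
    also have "\<dots> \<le> 2 * sin x" using half_le_sin[OF x(1) True] by simp
    finally show ?thesis unfolding eq
      by (rule order_trans[rotated]) (use assms in \<open>auto simp: divide_right_mono\<close>)
  next
    case False
    have "real (d - h) / real d \<le> pi - x"
      using big[of "real (d - h)"] assms by (simp add: x_def field_simps of_nat_diff)
    also have "\<dots> \<le> 2 * sin x" using half_le_sin[of "pi - x"] x False by simp
    finally show ?thesis unfolding eq
      by (rule order_trans[rotated]) (use assms in \<open>auto simp: divide_right_mono\<close>)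
  qed
qed

lemma norm_unity_root_diff_ge:
  assumes "a < d" "b < d" "a \<noteq> b"
  shows "norm (unity_root d a - unity_root d b) \<ge> 1 / real d"
proof -
  have *: "norm (unity_root d a - unity_root d b) \<ge> 1 / real d" if "b < a" "a < d" for a b
  proof -
    have "unity_root d a = unity_root d b * unity_root d (a - b)"
      using that by (simp add: unity_root_def cis_mult of_nat_diff field_simps flip: add_divide_distrib)
    then have "unity_root d a - unity_root d b = unity_root d b * (unity_root d (a - b) - 1)"
      by (simp add: algebra_simps)
    then have "norm (unity_root d a - unity_root d b) = norm (unity_root d (a - b) - 1)"
      by (simp add: norm_mult)
    moreover have "1 / real d \<le> min (real (a - b)) (real (d - (a - b))) / real d"
      using that by (intro divide_right_mono) auto
    ultimately show ?thesis
      using norm_unity_root_minus_one[of "a - b" d] that by linarith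
  qed
  show ?thesis
    using *[of b a] *[of a b] assms by (cases "b < a") (auto simp: norm_minus_commute)
qed

text \<open>The deficit \<open>1 - (norm s)^2\<close> of the combination \<open>s\<close> equals the
  sum over ordered pairs of \<open>a j * a j' * (norm (z j - z j'))^2 / 2\<close>. All terms are
  nonnegative, so the single pair \<open>(l, l')\<close> already bounds it below by
  \<open>D\<close>.\<close>

lemma norm_convex_combination_le:
  fixes z :: "'b \<Rightarrow> complex" and a :: "'b \<Rightarrow> real"
  assumes "finite J" "\<And>j. j \<in> J \<Longrightarrow> a j \<ge> \<delta>" "\<delta> \<ge> 0" "(\<Sum>j\<in>J. a j) = 1"
    and z: "\<And>j. j \<in> J \<Longrightarrow> norm (z j) = 1" and "l \<in> J" "l' \<in> J"
  shows "norm (\<Sum>j\<in>J. a j *\<^sub>R z j) \<le> 1 - \<delta>\<^sup>2 * (norm (z l - z l'))\<^sup>2 / 4"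
proof -
  let ?s = "\<Sum>j\<in>J. a j *\<^sub>R z j"
  define D where "D = \<delta>\<^sup>2 * (norm (z l - z l'))\<^sup>2 / 2"
  have a0: "a j \<ge> 0" if "j \<in> J" for j using assms that by (meson order_trans)
  have "(norm ?s)\<^sup>2 = (\<Sum>j\<in>J. \<Sum>j'\<in>J. a j * a j' * (z j \<bullet> z j'))"
    unfolding power2_norm_eq_inner inner_sum_left unfolding inner_sum_right
    by (intro sum.cong refl) (simp add: inner_commute)
  moreover have "(\<Sum>j\<in>J. \<Sum>j'\<in>J. a j * a j') = 1"
    by (simp add: assms(4) flip: sum_product)
  ultimately have "1 - (norm ?s)\<^sup>2 = (\<Sum>j\<in>J. \<Sum>j'\<in>J. a j * a j' * (1 - z j \<bullet> z j'))"
    by (simp add: right_diff_distrib sum_subtractf)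
  also have "\<dots> = (\<Sum>j\<in>J. \<Sum>j'\<in>J. a j * a j' * ((norm (z j - z j'))\<^sup>2 / 2))"
  proof (intro sum.cong refl)
    fix j j' assume "j \<in> J" "j' \<in> J"
    then have "z j \<bullet> z j = 1" "z j' \<bullet> z j' = 1" using z by (simp_all flip: power2_norm_eq_inner)
    then have "(norm (z j - z j'))\<^sup>2 = 2 - 2 * (z j \<bullet> z j')"
      by (simp add: power2_norm_eq_inner inner_diff_left inner_diff_right inner_commute)
    then show "a j * a j' * (1 - z j \<bullet> z j') = a j * a j' * ((norm (z j - z j'))\<^sup>2 / 2)" by simp
  qed
  also have "\<dots> \<ge> (\<Sum>j'\<in>J. a l * a j' * ((norm (z l - z j'))\<^sup>2 / 2))"
    by (intro member_le_sum[where i = l and f = "\<lambda>j. \<Sum>j'\<in>J. a j * a j' * ((norm (z j - z j'))\<^sup>2 / 2)"])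
      (use assms(1,6) a0 in \<open>simp_all add: sum_nonneg\<close>)
  also have "(\<Sum>j'\<in>J. a l * a j' * ((norm (z l - z j'))\<^sup>2 / 2)) \<ge> a l * a l' * ((norm (z l - z l'))\<^sup>2 / 2)"
    by (intro member_le_sum[where i = l' and f = "\<lambda>j'. a l * a j' * ((norm (z l - z j'))\<^sup>2 / 2)"])
      (use assms(1,6,7) a0 in simp_all)
  also have "a l * a l' * ((norm (z l - z l'))\<^sup>2 / 2) \<ge> D"
  proof -
    have "\<delta> * \<delta> \<le> a l * a l'"
      by (rule mult_mono) (simp_all add: assms(2,3,6,7) a0)
    then have "\<delta> * \<delta> * ((norm (z l - z l'))\<^sup>2 / 2) \<le> a l * a l' * ((norm (z l - z l'))\<^sup>2 / 2)"
      by (rule mult_right_mono) simp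
    then show ?thesis by (simp only: D_def power2_eq_square[of \<delta>] times_divide_eq_right)
  qed
  finally have "(norm ?s)\<^sup>2 \<le> 1 - D" by simp
  moreover have "1 - D \<le> (1 - D / 2)\<^sup>2" by (simp add: power2_eq_square algebra_simps)
  ultimately have sq: "(norm ?s)\<^sup>2 \<le> (1 - D / 2)\<^sup>2" by linarith
  \<comment> \<open>This makes \<open>1 - D / 2\<close> nonnegative, so that the squares may be
    compared.\<close>
  have "D \<le> 1" using \<open>(norm ?s)\<^sup>2 \<le> 1 - D\<close> zero_le_power2[of "norm ?s"] by linarith
  then have "norm ?s \<le> 1 - D / 2" by (intro power2_le_imp_le[OF sq]) simp
  then show ?thesis by (simp add: D_def)
qed

text \<open>On each side of \<open>i\<close> the exponent is injective in \<open>j\<close>, so each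
  half is part of a full geometric series.\<close>

lemma sum_power_dist_le:
  fixes \<rho> :: real
  assumes "0 \<le> \<rho>" "\<rho> < 1"
  shows "(\<Sum>j\<in>{1..n}. \<rho> ^ (if j \<le> i then i - j else j - i)) \<le> 2 / (1 - \<rho>)"
proof -
  have geo: "(\<Sum>j\<in>S. \<rho> ^ g j) \<le> 1 / (1 - \<rho>)" if "finite S" "inj_on g S" for S and g :: "nat \<Rightarrow> nat"
  proof -
    have "(\<Sum>j\<in>S. \<rho> ^ g j) = (\<Sum>t\<in>g ` S. \<rho> ^ t)" using that by (simp add: sum.reindex)
    also have "\<dots> \<le> (\<Sum>t. \<rho> ^ t)"
      using assms that by (intro sum_le_suminf summable_geometric) auto
    also have "\<dots> = 1 / (1 - \<rho>)" using assms by (simp add: suminf_geometric)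
    finally show ?thesis .
  qed
  have "(\<Sum>j\<in>{1..n}. \<rho> ^ (if j \<le> i then i - j else j - i))
      = (\<Sum>j\<in>{1..n} \<inter> {j. j \<le> i}. \<rho> ^ (i - j)) + (\<Sum>j\<in>{1..n} \<inter> - {j. j \<le> i}. \<rho> ^ (j - i))"
    by (subst sum.If_cases[symmetric]) (auto intro: sum.cong)
  also have "\<dots> \<le> 1 / (1 - \<rho>) + 1 / (1 - \<rho>)"
    by (intro add_mono geo) (auto simp: inj_on_def)
  finally show ?thesis by simp
qed

section \<open>Second moments of character sums\<close>

text \<open>The finite set of types is condensed into one constant \<delta> below all step
  probabilities; the law of a step may vary with time.\<close>

locale lattice_walk = prob_space M for M :: "'a measure" +
  fixes k :: nat and W :: "nat \<Rightarrow> 'a \<Rightarrow> nat" and \<delta> :: real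
  assumes k_ge_2: "2 \<le> k"
    and \<delta>_pos: "0 < \<delta>"
    and indep_steps: "indep_vars (\<lambda>_. count_space UNIV) W {1..}"
    and step_prob_ge: "\<And>i j. 1 \<le> i \<Longrightarrow> j < k \<Longrightarrow> \<delta> \<le> prob {\<omega> \<in> space M. W i \<omega> = j}"
    and step_prob_sum: "\<And>i. 1 \<le> i \<Longrightarrow> (\<Sum>j<k. prob {\<omega> \<in> space M. W i \<omega> = j}) = 1"
begin

lemma step_measurable [measurable]: "1 \<le> i \<Longrightarrow> W i \<in> M \<rightarrow>\<^sub>M count_space UNIV"
  using indep_steps by (auto simp: indep_vars_def)

lemma step_compose_measurable [measurable]:
  "1 \<le> i \<Longrightarrow> (\<lambda>\<omega>. f (W i \<omega>)) \<in> M \<rightarrow>\<^sub>M borel"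
  by (rule measurable_compose[OF step_measurable]) simp_all

lemma \<delta>_le_1: "\<delta> \<le> 1"
  by (rule order_trans[OF step_prob_ge[of 1 0] prob_le_1]) (use k_ge_2 in simp_all)

text \<open>The \<open>k\<close> listed values carry total mass 1. Values of \<open>W i\<close>
  outside them are possible on a null set only, hence the almost sure form of the identities built
  on this.\<close>

lemma AE_step_less: "AE \<omega> in M. \<forall>i\<ge>1. W i \<omega> < k"
proof -
  have "AE \<omega> in M. W i \<omega> < k" if i: "1 \<le> i" for i
  proof -
    have [measurable]: "{\<omega> \<in> space M. W i \<omega> = j} \<in> events" for j
      using step_measurable[OF i] by measurable
    have "prob (\<Union>j<k. {\<omega> \<in> space M. W i \<omega> = j}) = (\<Sum>j<k. prob {\<omega> \<in> space M. W i \<omega> = j})"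
      by (intro finite_measure_finite_Union) (auto simp: disjoint_family_on_def)
    then have "prob (\<Union>j<k. {\<omega> \<in> space M. W i \<omega> = j}) = 1" using step_prob_sum[OF i] by simp
    then have "AE \<omega> in M. \<omega> \<in> (\<Union>j<k. {\<omega> \<in> space M. W i \<omega> = j})"
      by (subst (asm) prob_eq_1) auto
    then show ?thesis by eventually_elim auto
  qed
  then show ?thesis by (simp add: AE_all_countable)
qed

lemma expectation_step:
  fixes f :: "nat \<Rightarrow> complex"
  assumes i: "1 \<le> i"
  shows "expectation (\<lambda>\<omega>. f (W i \<omega>)) = (\<Sum>j<k. prob {\<omega> \<in> space M. W i \<omega> = j} *\<^sub>R f j)"
proof -
  have [measurable]: "{\<omega> \<in> space M. W i \<omega> = j} \<in> events" for j
    using step_measurable[OF i] by measurable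
  have "expectation (\<lambda>\<omega>. f (W i \<omega>))
      = expectation (\<lambda>\<omega>. \<Sum>j<k. indicator {\<omega> \<in> space M. W i \<omega> = j} \<omega> *\<^sub>R f j)"
  proof (rule integral_cong_AE)
    show "(\<lambda>\<omega>. f (W i \<omega>)) \<in> borel_measurable M" using i by measurable
    show "AE \<omega> in M. f (W i \<omega>) = (\<Sum>j<k. indicator {\<omega> \<in> space M. W i \<omega> = j} \<omega> *\<^sub>R f j)"
      using AE_step_less AE_space
    proof eventually_elim
      case (elim \<omega>)
      have "(\<Sum>j<k. indicator {\<omega> \<in> space M. W i \<omega> = j} \<omega> *\<^sub>R f j) = (\<Sum>j<k. if W i \<omega> = j then f j else 0)"
        using elim by (intro sum.cong) (auto simp: indicator_def)
      then show ?case using elim i by (simp add: sum.delta')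
    qed
  qed measurable
  also have "\<dots> = (\<Sum>j<k. prob {\<omega> \<in> space M. W i \<omega> = j} *\<^sub>R f j)"
    by (subst Bochner_Integration.integral_sum) (auto simp: integrable_indicator_iff less_top[symmetric])
  finally show ?thesis .
qed

text \<open>Independence factors the expectation, and each factor is a convex combination of unit
  numbers whose weights are at least \<delta>.\<close>

lemma norm_expectation_prod_steps_le:
  fixes u :: "nat \<Rightarrow> complex"
  assumes I: "finite I" "I \<subseteq> {1..}" and u: "\<And>j. norm (u j) = 1" and l: "l < k" "l' < k"
  shows "norm (expectation (\<lambda>\<omega>. \<Prod>i\<in>I. u (W i \<omega>)))
      \<le> (1 - \<delta>\<^sup>2 * (norm (u l - u l'))\<^sup>2 / 4) ^ card I"
proof -
  have int: "integrable M (\<lambda>\<omega>. u (W i \<omega>))" if "i \<in> I" for i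
    using that I by (intro integrable_const_bound[where B = 1]) (auto simp: u)
  have "indep_vars (\<lambda>_. borel) (\<lambda>i \<omega>. u (W i \<omega>)) I"
    using indep_vars_subset[OF indep_steps I(2)] by (rule indep_vars_compose2) auto
  then have "expectation (\<lambda>\<omega>. \<Prod>i\<in>I. u (W i \<omega>)) = (\<Prod>i\<in>I. expectation (\<lambda>\<omega>. u (W i \<omega>)))"
    using int I by (intro indep_vars_lebesgue_integral) auto
  also have "norm \<dots> \<le> (\<Prod>i\<in>I. 1 - \<delta>\<^sup>2 * (norm (u l - u l'))\<^sup>2 / 4)"
    unfolding prod_norm[symmetric]
  proof (intro prod_mono conjI)
    fix i assume "i \<in> I"
    then have i: "1 \<le> i" using I by auto
    show "norm (expectation (\<lambda>\<omega>. u (W i \<omega>))) \<le> 1 - \<delta>\<^sup>2 * (norm (u l - u l'))\<^sup>2 / 4"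
      unfolding expectation_step[OF i]
      using \<delta>_pos step_prob_ge[OF i] step_prob_sum[OF i] l
      by (intro norm_convex_combination_le) (auto simp: u)
  qed simp
  finally show ?thesis by simp
qed

text \<open>Second moment method: for \<open>j <= i\<close> the product of \<xi> \<open>i\<close>
  with the conjugate of \<xi> \<open>j\<close> involves only the steps after \<open>j\<close>, so
  correlations decay geometrically in the time distance. Summing them gives a second moment linear
  in \<open>n\<close>.\<close>

lemma expectation_norm_char_sum_le:
  fixes u :: "nat \<Rightarrow> complex"
  assumes u: "\<And>j. norm (u j) = 1" and l: "l < k" "l' < k" "u l \<noteq> u l'"
  shows "expectation (\<lambda>\<omega>. norm (\<Sum>i\<in>{1..n}. \<Prod>s\<in>{1..i}. u (W s \<omega>)))
      \<le> 3 * sqrt n / (\<delta> * norm (u l - u l'))"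
proof -
  define \<xi> where "\<xi> i \<omega> = (\<Prod>s\<in>{1..i}. u (W s \<omega>))" for i :: nat and \<omega>
  define \<rho> where "\<rho> = 1 - \<delta>\<^sup>2 * (norm (u l - u l'))\<^sup>2 / 4"
  define S where "S \<omega> = norm (\<Sum>i\<in>{1..n}. \<xi> i \<omega>)" for \<omega>
  have \<rho>1: "\<rho> < 1" using \<delta>_pos l by (simp add: \<rho>_def)
  \<comment> \<open>Applied to a single step, the contraction bound puts a norm below
    \<rho>.\<close>
  have \<rho>0: "0 \<le> \<rho>"
  proof -
    have "norm (expectation (\<lambda>\<omega>. \<Prod>i\<in>{1::nat}. u (W i \<omega>))) \<le> \<rho> ^ card {1::nat}"
      unfolding \<rho>_def by (intro norm_expectation_prod_steps_le u l) auto
    then show ?thesis by (simp add: order_trans[OF norm_ge_zero])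
  qed
  have [measurable]: "\<xi> i \<in> borel_measurable M" for i
    unfolding \<xi>_def by (intro borel_measurable_prod step_compose_measurable) auto
  have n\<xi>: "norm (\<xi> i \<omega>) = 1" for i \<omega> by (simp add: \<xi>_def u flip: prod_norm)
  have split: "\<xi> i \<omega> * cnj (\<xi> j \<omega>) = (\<Prod>s\<in>{j<..i}. u (W s \<omega>))" if "j \<le> i" for i j \<omega>
  proof -
    have "{1..i} = {1..j} \<union> {j<..i}" using that by auto
    then have "\<xi> i \<omega> = \<xi> j \<omega> * (\<Prod>s\<in>{j<..i}. u (W s \<omega>))"
      unfolding \<xi>_def by (subst prod.union_disjoint[symmetric]) auto
    moreover have "\<xi> j \<omega> * cnj (\<xi> j \<omega>) = 1"
      using n\<xi>[of j \<omega>] by (simp flip: complex_norm_square)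
    ultimately show ?thesis by (simp add: mult_ac)
  qed
  have le: "norm (expectation (\<lambda>\<omega>. \<xi> i \<omega> * cnj (\<xi> j \<omega>))) \<le> \<rho> ^ (i - j)" if "j \<le> i" for i j
    using norm_expectation_prod_steps_le[OF _ _ u l(1,2), of "{j<..i}"]
    by (simp add: split[OF that] \<rho>_def subset_iff)
  have corr: "norm (expectation (\<lambda>\<omega>. \<xi> i \<omega> * cnj (\<xi> j \<omega>))) \<le> \<rho> ^ (if j \<le> i then i - j else j - i)" for i j
  proof (cases "j \<le> i")
    case False
    have "expectation (\<lambda>\<omega>. \<xi> i \<omega> * cnj (\<xi> j \<omega>)) = cnj (expectation (\<lambda>\<omega>. \<xi> j \<omega> * cnj (\<xi> i \<omega>)))"
      unfolding Bochner_Integration.integral_cnj[symmetric] by (simp add: mult.commute)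
    then show ?thesis using le[of i j] False by simp
  qed (use le in simp)
  have [measurable]: "cnj \<in> borel_measurable borel"
    by (intro borel_measurable_continuous_onI continuous_intros)
  have int: "integrable M (\<lambda>\<omega>. \<xi> i \<omega> * cnj (\<xi> j \<omega>))" for i j
    by (intro integrable_const_bound[where B = 1]) (auto simp: norm_mult n\<xi>)
  have sq_eq: "S \<omega> ^ 2 = Re (\<Sum>i\<in>{1..n}. \<Sum>j\<in>{1..n}. \<xi> i \<omega> * cnj (\<xi> j \<omega>))" for \<omega>
  proof -
    have "complex_of_real (S \<omega> ^ 2) = (\<Sum>i\<in>{1..n}. \<Sum>j\<in>{1..n}. \<xi> i \<omega> * cnj (\<xi> j \<omega>))"
      unfolding S_def complex_norm_square cnj_sum sum_product ..
    then show ?thesis by (metis Re_complex_of_real)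
  qed
  have "expectation (\<lambda>\<omega>. S \<omega> ^ 2)
      = Re (expectation (\<lambda>\<omega>. \<Sum>i\<in>{1..n}. \<Sum>j\<in>{1..n}. \<xi> i \<omega> * cnj (\<xi> j \<omega>)))"
    unfolding sq_eq by (intro integral_Re Bochner_Integration.integrable_sum int)
  also have "\<dots> = Re (\<Sum>i\<in>{1..n}. \<Sum>j\<in>{1..n}. expectation (\<lambda>\<omega>. \<xi> i \<omega> * cnj (\<xi> j \<omega>)))"
    by (subst Bochner_Integration.integral_sum, intro Bochner_Integration.integrable_sum int,
        subst Bochner_Integration.integral_sum, intro int, rule refl)
  also have "\<dots> \<le> (\<Sum>i\<in>{1..n}. \<Sum>j\<in>{1..n}. norm (expectation (\<lambda>\<omega>. \<xi> i \<omega> * cnj (\<xi> j \<omega>))))"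
    by (rule order_trans[OF complex_Re_le_cmod]) (intro sum_norm_le order_refl)
  also have "\<dots> \<le> (\<Sum>i\<in>{1..n}. \<Sum>j\<in>{1..n}. \<rho> ^ (if j \<le> i then i - j else j - i))"
    by (intro sum_mono corr)
  also have "\<dots> \<le> (\<Sum>i\<in>{1..n}. 2 / (1 - \<rho>))"
    by (intro sum_mono sum_power_dist_le \<rho>0 \<rho>1)
  also have "\<dots> = 8 * real n / (\<delta> * norm (u l - u l'))\<^sup>2"
    by (simp add: \<rho>_def power_mult_distrib)
  \<comment> \<open>The constant 8 is rounded up to a perfect square.\<close>
  also have "\<dots> \<le> 9 * real n / (\<delta> * norm (u l - u l'))\<^sup>2"
    by (intro divide_right_mono) auto
  also have "\<dots> = (3 * sqrt n / (\<delta> * norm (u l - u l')))\<^sup>2"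
    by (simp add: power_mult_distrib power_divide)
  finally have sq: "expectation (\<lambda>\<omega>. S \<omega> ^ 2) \<le> (3 * sqrt n / (\<delta> * norm (u l - u l')))\<^sup>2" .
  have [measurable]: "S \<in> borel_measurable M" unfolding S_def by measurable
  have Sb: "\<bar>S \<omega>\<bar> \<le> n" for \<omega>
  proof -
    have "S \<omega> \<le> (\<Sum>i\<in>{1..n}. norm (\<xi> i \<omega>))" unfolding S_def by (rule norm_sum)
    then show ?thesis by (simp add: n\<xi> S_def)
  qed
  have i1: "integrable M S"
    using Sb by (intro integrable_const_bound[where B = n]) auto
  have "\<bar>S \<omega> ^ 2\<bar> \<le> real n ^ 2" for \<omega> using power_mono[OF Sb[of \<omega>], of 2] by simp
  then have i2: "integrable M (\<lambda>\<omega>. S \<omega> ^ 2)"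
    by (intro integrable_const_bound[where B = "real n ^ 2"]) auto
  \<comment> \<open>Nonnegativity of the variance passes from the second moment to the
    first.\<close>
  have "(expectation S)\<^sup>2 \<le> expectation (\<lambda>\<omega>. S \<omega> ^ 2)"
    using variance_positive[of S] unfolding variance_eq[OF i1 i2] by linarith
  then have "expectation S \<le> 3 * sqrt n / (\<delta> * norm (u l - u l'))"
    by (rule power2_le_imp_le[OF order_trans[OF _ sq]]) (use \<delta>_pos in simp)
  then show ?thesis by (simp add: S_def[abs_def] \<xi>_def)
qed

end

section \<open>Equidistribution modulo a fixed number\<close>

text \<open>The coordinates of the walk as natural numbers, so that they can serve as exponents and
  in divisibility over \<open>nat\<close>.\<close>

definition visits :: "(nat \<Rightarrow> 'a \<Rightarrow> nat) \<Rightarrow> nat \<Rightarrow> 'a \<Rightarrow> nat \<Rightarrow> nat" where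
  "visits W i \<omega> j = card {s \<in> {1..i}. W s \<omega> = j}"

lemma power_visits:
  fixes z :: complex
  shows "z ^ visits W i \<omega> j = (\<Prod>s\<in>{1..i}. if W s \<omega> = j then z else 1)"
  unfolding visits_def prod_constant[symmetric] by (rule prod.inter_filter) simp

text \<open>A character of the position becomes a product over the steps, the form to which
  independence applies. Steps outside \<open>{..<k}\<close> contribute the factor 1.\<close>

lemma prod_power_visits:
  fixes z :: "nat \<Rightarrow> complex"
  shows "(\<Prod>j<k. z j ^ visits W i \<omega> j) = (\<Prod>s\<in>{1..i}. if W s \<omega> < k then z (W s \<omega>) else 1)"
proof -
  have "(\<Prod>j<k. z j ^ visits W i \<omega> j) = (\<Prod>s\<in>{1..i}. \<Prod>j<k. if W s \<omega> = j then z j else 1)"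
    unfolding power_visits by (rule prod.swap)
  then show ?thesis by (simp add: prod.delta')
qed

definition dvd_visits :: "nat \<Rightarrow> nat \<Rightarrow> (nat \<Rightarrow> 'a \<Rightarrow> nat) \<Rightarrow> nat \<Rightarrow> 'a \<Rightarrow> bool" where
  "dvd_visits k d W i \<omega> \<longleftrightarrow> (\<forall>j<k. d dvd visits W i \<omega> j)"

text \<open>Orthogonality is applied in each coordinate, and the product of sums is expanded; every
  \<open>h\<close> stands for one character modulo \<open>d\<close> in \<open>k\<close>
  coordinates.\<close>

lemma of_bool_dvd_visits:
  assumes "d > 0"
  shows "(of_bool (dvd_visits k d W i \<omega>) :: complex)
    = (\<Sum>h\<in>{..<k} \<rightarrow>\<^sub>E {..<d}. \<Prod>s\<in>{1..i}. if W s \<omega> < k then unity_root d (h (W s \<omega>)) else 1) / of_nat d ^ k"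
proof -
  have "(\<Sum>h\<in>{..<k} \<rightarrow>\<^sub>E {..<d}. \<Prod>j<k. unity_root d (h j) ^ visits W i \<omega> j)
      = (\<Prod>j<k. \<Sum>h<d. unity_root d h ^ visits W i \<omega> j)"
    by (rule prod_sum_PiE[symmetric]) auto
  also have "\<dots> = (\<Prod>j<k. of_nat d * of_bool (d dvd visits W i \<omega> j))"
    using assms by (intro prod.cong) (auto simp: sum_unity_root_power)
  also have "\<dots> = of_nat d ^ k * of_bool (dvd_visits k d W i \<omega>)"
    by (auto simp: prod.distrib dvd_visits_def)
  finally show ?thesis
    using assms by (simp add: prod_power_visits)
qed

definition dvd_freq :: "nat \<Rightarrow> nat \<Rightarrow> (nat \<Rightarrow> 'a \<Rightarrow> nat) \<Rightarrow> nat \<Rightarrow> 'a \<Rightarrow> real" where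
  "dvd_freq k d W n \<omega> = (\<Sum>i\<in>{1..n}. of_bool (dvd_visits k d W i \<omega>)) / real n"

lemma dvd_freq_nonneg: "0 \<le> dvd_freq k d W n \<omega>"
  by (simp add: dvd_freq_def sum_nonneg)

lemma dvd_freq_le_1: "dvd_freq k d W n \<omega> \<le> 1"
proof -
  have "(\<Sum>i\<in>{1..n}. of_bool (dvd_visits k d W i \<omega>)) \<le> (\<Sum>i\<in>{1..n}. 1 :: real)"
    by (intro sum_mono) auto
  then show ?thesis by (auto simp: dvd_freq_def divide_simps)
qed

lemma sum_power_unit_le:
  fixes z :: complex
  assumes "norm z = 1" "z \<noteq> 1"
  shows "norm (\<Sum>i\<in>{1..n}. z ^ i) \<le> 2 / norm (z - 1)"
proof -
  have "(\<Sum>i\<in>{1..n}. z ^ i) = z * (\<Sum>i<n. z ^ i)"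
    by (simp add: sum_distrib_left sum.atLeast1_atMost_eq)
  also have "\<dots> = z * ((1 - z ^ n) / (1 - z))" using assms by (simp add: sum_gp_strict)
  also have "norm \<dots> = norm (1 - z ^ n) / norm (z - 1)"
    by (simp add: norm_mult norm_divide assms norm_minus_commute)
  also have "norm (1 - z ^ n) \<le> 2"
    using norm_triangle_ineq4[of 1 "z ^ n"] by (simp add: norm_power assms)
  finally show ?thesis by (simp add: divide_right_mono)
qed

context lattice_walk
begin

lemma visits_measurable [measurable]: "(\<lambda>\<omega>. visits W i \<omega> j) \<in> M \<rightarrow>\<^sub>M count_space UNIV"
proof (induction i)
  case (Suc i)
  have "{s \<in> {1..Suc i}. W s \<omega> = j}
      = {s \<in> {1..i}. W s \<omega> = j} \<union> (if W (Suc i) \<omega> = j then {Suc i} else {})" for \<omega>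
    by (auto simp: le_Suc_eq)
  then have eq: "visits W (Suc i) \<omega> j = (if W (Suc i) \<omega> = j then Suc (visits W i \<omega> j) else visits W i \<omega> j)" for \<omega>
    by (auto simp: visits_def card_insert_if)
  have [measurable]: "W (Suc i) \<in> M \<rightarrow>\<^sub>M count_space UNIV" by (rule step_measurable) simp
  note Suc.IH [measurable]
  show ?case unfolding eq by measurable
qed (simp add: visits_def)

lemma dvd_visits_measurable [measurable]: "Measurable.pred M (dvd_visits k d W i)"
  unfolding dvd_visits_def[abs_def] by measurable

lemma dvd_freq_measurable [measurable]: "dvd_freq k d W n \<in> borel_measurable M"
  unfolding dvd_freq_def[abs_def] by measurable

text \<open>Each step raises exactly one of the \<open>k\<close> coordinates. Consequently a common
  divisor of the coordinates divides the time.\<close>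

lemma AE_visits_sum: "AE \<omega> in M. \<forall>i. (\<Sum>j<k. visits W i \<omega> j) = i"
  using AE_step_less
proof eventually_elim
  case (elim \<omega>)
  show ?case
  proof
    fix i
    have "(\<Sum>j<k. visits W i \<omega> j) = card (\<Union>j<k. {s \<in> {1..i}. W s \<omega> = j})"
      unfolding visits_def by (subst card_UN_disjoint) auto
    also have "(\<Union>j<k. {s \<in> {1..i}. W s \<omega> = j}) = {1..i}" using elim by auto
    finally show "(\<Sum>j<k. visits W i \<omega> j) = i" by simp
  qed
qed

text \<open>If \<open>h\<close> is not constant, two of its values differ by at least
  \<open>1 / d\<close> on the unit circle and the second moment bound applies. If it is constant,
  the character sees only the coordinate sum, which is the time, and the sum is a deterministic
  geometric one. The stated bound covers both.\<close>

lemma expectation_character_sum_le: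
  assumes h: "h \<in> {..<k} \<rightarrow>\<^sub>E {..<d}" and j0: "j0 < k" "h j0 \<noteq> 0" and d: "0 < d"
  defines "u \<equiv> \<lambda>m. if m < k then unity_root d (h m) else 1"
  shows "expectation (\<lambda>\<omega>. norm (\<Sum>i\<in>{1..n}. \<Prod>s\<in>{1..i}. u (W s \<omega>))) \<le> 3 * real d * sqrt n / \<delta>"
proof (cases "\<exists>l<k. h l \<noteq> h j0")
  case True
  then obtain l where l: "l < k" "h l \<noteq> h j0" by auto
  have hd: "h m < d" if "m < k" for m using h that by auto
  have ge: "1 / real d \<le> norm (u l - u j0)"
    unfolding u_def using l j0 hd by (simp add: norm_unity_root_diff_ge)
  have pos: "0 < norm (u l - u j0)" using ge d by (smt (verit) of_nat_0_less_iff zero_less_divide_1_iff)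
  have "expectation (\<lambda>\<omega>. norm (\<Sum>i\<in>{1..n}. \<Prod>s\<in>{1..i}. u (W s \<omega>))) \<le> 3 * sqrt n / (\<delta> * norm (u l - u j0))"
    using pos by (intro expectation_norm_char_sum_le l j0) (auto simp: u_def)
  also have "\<dots> \<le> 3 * sqrt n / (\<delta> * (1 / real d))"
    using ge \<delta>_pos d by (intro divide_left_mono mult_left_mono mult_pos_pos pos) auto
  also have "\<dots> = 3 * real d * sqrt n / \<delta>" by simp
  finally show ?thesis .
next
  case False
  define z where "z = unity_root d (h j0)"
  have "h j0 < d" using h j0 by auto
  then have "1 / real d \<le> norm (unity_root d (h j0) - unity_root d 0)"
    using j0 d by (intro norm_unity_root_diff_ge) auto
  then have z1: "1 / real d \<le> norm (z - 1)" by (simp add: z_def unity_root_def)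
  have pos: "0 < norm (z - 1)" using z1 d by (smt (verit) of_nat_0_less_iff zero_less_divide_1_iff)
  have "AE \<omega> in M. norm (\<Sum>i\<in>{1..n}. \<Prod>s\<in>{1..i}. u (W s \<omega>)) = norm (\<Sum>i\<in>{1..n}. z ^ i)"
    using AE_step_less
  proof eventually_elim
    case (elim \<omega>)
    have "u (W s \<omega>) = z" if "1 \<le> s" for s using elim that False by (auto simp: u_def z_def)
    then have "(\<Prod>s\<in>{1..i}. u (W s \<omega>)) = z ^ i" for i by simp
    then show ?case by simp
  qed
  moreover have "(\<lambda>\<omega>. \<Sum>i\<in>{1..n}. \<Prod>s\<in>{1..i}. u (W s \<omega>)) \<in> borel_measurable M"
    by (intro borel_measurable_sum borel_measurable_prod step_compose_measurable) auto
  ultimately have "expectation (\<lambda>\<omega>. norm (\<Sum>i\<in>{1..n}. \<Prod>s\<in>{1..i}. u (W s \<omega>)))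
      = expectation (\<lambda>\<omega>. norm (\<Sum>i\<in>{1..n}. z ^ i))"
    by (intro integral_cong_AE) auto
  also have "\<dots> = norm (\<Sum>i\<in>{1..n}. z ^ i)" by (simp add: prob_space)
  also have "\<dots> \<le> 3 * real d * sqrt n / \<delta>"
  \<comment> \<open>At \<open>n = 0\<close> both sides vanish; otherwise \<open>1 <= sqrt n\<close>
    absorbs the bound \<open>2 * d\<close>.\<close>
  proof (cases "n = 0")
    case False
    have "norm (\<Sum>i\<in>{1..n}. z ^ i) \<le> 2 / norm (z - 1)"
      using pos by (intro sum_power_unit_le) (auto simp: z_def)
    also have "\<dots> \<le> 2 / (1 / real d)" using z1 d pos by (intro divide_left_mono) auto
    also have "\<dots> = 2 * real d * 1 / 1" by simp
    also have "\<dots> \<le> 3 * real d * sqrt n / \<delta>"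
      using False \<delta>_pos \<delta>_le_1 by (intro frac_le mult_mono) auto
    finally show ?thesis .
  qed simp
  finally show ?thesis .
qed

text \<open>The trivial character \<open>h0\<close> yields the main term \<open>1 / d^k\<close>. The
  remaining characters number fewer than \<open>d^k\<close>, which the normalisation cancels, so the
  bound for a single character survives.\<close>

lemma expectation_dvd_freq_dist_le:
  assumes d: "0 < d" and n: "0 < n"
  shows "expectation (\<lambda>\<omega>. \<bar>dvd_freq k d W n \<omega> - 1 / real d ^ k\<bar>) \<le> 3 * real d / (\<delta> * sqrt n)"
proof -
  define u where "u h m = (if m < k then unity_root d (h m) else 1)" for h m
  define H where "H = ({..<k} \<rightarrow>\<^sub>E {..<d})"
  define h0 where "h0 = (\<lambda>j\<in>{..<k}. 0 :: nat)"
  define S where "S h \<omega> = (\<Sum>i\<in>{1..n}. \<Prod>s\<in>{1..i}. u h (W s \<omega>))" for h \<omega>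
  have finH: "finite H" by (auto simp: H_def intro: finite_PiE)
  have cardH: "card H = d ^ k" by (simp add: H_def card_PiE)
  have h0: "h0 \<in> H" using d by (auto simp: h0_def H_def)
  have Sh0: "S h0 \<omega> = of_nat n" for \<omega>
  proof -
    have "u h0 m = 1" for m by (simp add: u_def h0_def unity_root_def)
    then show ?thesis by (simp add: S_def)
  qed
  have S_meas [measurable]: "S h \<in> borel_measurable M" for h
    unfolding S_def[abs_def]
    by (intro borel_measurable_sum borel_measurable_prod step_compose_measurable) auto
  have Sn: "norm (S h \<omega>) \<le> n" for h \<omega>
  proof -
    have "norm (S h \<omega>) \<le> (\<Sum>i\<in>{1..n}. norm (\<Prod>s\<in>{1..i}. u h (W s \<omega>)))"
      unfolding S_def by (rule norm_sum)
    moreover have "norm (u h m) = 1" for m by (simp add: u_def)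
    ultimately show ?thesis by (simp flip: prod_norm)
  qed
  have Sint: "integrable M (\<lambda>\<omega>. norm (S h \<omega>))" for h
    using Sn by (intro integrable_const_bound[where B = n]) auto
  have ES: "expectation (\<lambda>\<omega>. norm (S h \<omega>)) \<le> 3 * real d * sqrt n / \<delta>" if h: "h \<in> H - {h0}" for h
  proof -
    have "\<exists>j0<k. h j0 \<noteq> 0"
    proof (rule ccontr)
      assume "\<not> ?thesis"
      then have "h = h0" using h by (intro ext) (auto simp: h0_def H_def PiE_def extensional_def)
      then show False using h by simp
    qed
    then obtain j0 where "j0 < k" "h j0 \<noteq> 0" by auto
    then show ?thesis
      unfolding S_def u_def using h d by (intro expectation_character_sum_le) (auto simp: H_def)
  qed
  have bound: "\<bar>dvd_freq k d W n \<omega> - 1 / real d ^ k\<bar> \<le> (\<Sum>h\<in>H - {h0}. norm (S h \<omega>)) / (real d ^ k * real n)" for \<omega>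
  proof -
    have "complex_of_real (dvd_freq k d W n \<omega>) = (\<Sum>i\<in>{1..n}. of_bool (dvd_visits k d W i \<omega>)) / of_nat n"
      by (simp add: dvd_freq_def)
    also have "\<dots> = (\<Sum>h\<in>H. S h \<omega>) / (of_nat d ^ k * of_nat n)"
      unfolding of_bool_dvd_visits[OF d] S_def u_def H_def
      by (subst sum.swap) (simp add: sum_divide_distrib[symmetric])
    also have "\<dots> = (\<Sum>h\<in>H - {h0}. S h \<omega>) / (of_nat d ^ k * of_nat n) + 1 / of_nat d ^ k"
      using n by (subst sum.remove[OF finH h0]) (simp add: Sh0 add_divide_distrib)
    finally have "complex_of_real (dvd_freq k d W n \<omega> - 1 / real d ^ k)
        = (\<Sum>h\<in>H - {h0}. S h \<omega>) / (of_nat d ^ k * of_nat n)" by simp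
    then have "\<bar>dvd_freq k d W n \<omega> - 1 / real d ^ k\<bar> = norm ((\<Sum>h\<in>H - {h0}. S h \<omega>) / (of_nat d ^ k * of_nat n))"
      by (metis norm_of_real)
    also have "\<dots> = norm (\<Sum>h\<in>H - {h0}. S h \<omega>) / (real d ^ k * real n)"
      by (simp add: norm_divide norm_mult norm_power)
    also have "\<dots> \<le> (\<Sum>h\<in>H - {h0}. norm (S h \<omega>)) / (real d ^ k * real n)"
      by (intro divide_right_mono norm_sum) auto
    finally show ?thesis .
  qed
  have "expectation (\<lambda>\<omega>. \<bar>dvd_freq k d W n \<omega> - 1 / real d ^ k\<bar>)
      \<le> expectation (\<lambda>\<omega>. (\<Sum>h\<in>H - {h0}. norm (S h \<omega>)) / (real d ^ k * real n))"
    by (rule integral_mono')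
      (use bound Sint in \<open>auto intro!: Bochner_Integration.integrable_divide Bochner_Integration.integrable_sum
        divide_nonneg_nonneg sum_nonneg\<close>)
  also have "\<dots> = (\<Sum>h\<in>H - {h0}. expectation (\<lambda>\<omega>. norm (S h \<omega>))) / (real d ^ k * real n)"
    using Sint by simp
  also have "\<dots> \<le> (\<Sum>h\<in>H - {h0}. 3 * real d * sqrt n / \<delta>) / (real d ^ k * real n)"
    by (intro divide_right_mono sum_mono ES) auto
  also have "\<dots> \<le> (\<Sum>h\<in>H. 3 * real d * sqrt n / \<delta>) / (real d ^ k * real n)"
    using \<delta>_pos finH by (intro divide_right_mono sum_mono2) auto
  also have "\<dots> = 3 * real d / (\<delta> * (real n / sqrt n))"
    using d n \<delta>_pos by (simp add: cardH)
  also have "real n / sqrt n = sqrt n" by (rule real_div_sqrt) simp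
  finally show ?thesis .
qed

end

section \<open>Large divisors\<close>

text \<open>Since \<open>(sqrt x - 1)^2 >= 0\<close>, one has
  \<open>sqrt x <= 1 + x <= exp x\<close>. Trading the exponential for a power makes the sum over
  frequencies harmonic.\<close>

lemma exp_minus_le_inverse_sqrt:
  fixes x :: real
  assumes "0 < x"
  shows "exp (- x) \<le> 1 / sqrt x"
proof -
  have "0 \<le> (sqrt x - 1)\<^sup>2" by simp
  then have "2 * sqrt x \<le> 1 + x" using assms by (simp add: power2_diff)
  moreover have "0 < sqrt x" using assms by simp
  ultimately have "sqrt x \<le> 1 + x" by linarith
  also have "\<dots> \<le> exp x" by (rule exp_ge_add_one_self)
  finally have "1 / exp x \<le> 1 / sqrt x" using assms by (intro divide_left_mono) auto
  then show ?thesis by (simp add: exp_minus inverse_eq_divide)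
qed

text \<open>The two summands are exchanged by \<open>h\<close> to \<open>d - h\<close>; together
  they dominate the inverse of \<open>min h (d - h)\<close>.\<close>

lemma sum_inverse_reflect_le_harm:
  fixes d :: nat
  shows "(\<Sum>h\<in>{0<..<d}. 1 / real h + 1 / real (d - h)) \<le> 2 * harm d"
proof -
  have "(\<Sum>h\<in>{0<..<d}. 1 / real (d - h)) = (\<Sum>h\<in>{0<..<d}. 1 / real h)"
    by (rule sum.reindex_bij_witness[of _ "\<lambda>h. d - h" "\<lambda>h. d - h"]) auto
  moreover have "(\<Sum>h\<in>{0<..<d}. 1 / real h) \<le> harm d"
    unfolding harm_def by (simp add: inverse_eq_divide) (intro sum_mono2, auto)
  ultimately show ?thesis by (simp add: sum.distrib)
qed

lemma harm_le_one_plus_ln: "0 < n \<Longrightarrow> harm n \<le> 1 + ln (real n)"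
  using decseqD[OF decseq_harm_diff_ln, of 0 "n - 1"] by (simp add: harm_def)

lemma card_multiples_le:
  assumes "0 < d"
  shows "real (card {i \<in> {1..n}. d dvd i}) \<le> real n / real d"
proof -
  have "{i \<in> {1..n}. d dvd i} \<subseteq> (*) d ` {1..n div d}"
  proof
    fix i assume "i \<in> {i \<in> {1..n}. d dvd i}"
    then obtain t where t: "i = d * t" "1 \<le> i" "i \<le> n" by auto
    then have "1 \<le> t" by (cases t) auto
    moreover have "t \<le> n div d"
      using t assms by (simp add: less_eq_div_iff_mult_less_eq mult.commute)
    ultimately show "i \<in> (*) d ` {1..n div d}" using t by auto
  qed
  then have le: "card {i \<in> {1..n}. d dvd i} \<le> card {1..n div d}"
    by (rule surj_card_le[rotated]) simp
  have "real (card {i \<in> {1..n}. d dvd i}) \<le> real (n div d)" using le by simp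
  also have "\<dots> \<le> real n / real d" by (rule of_nat_div_le_of_nat)
  finally show ?thesis .
qed

context lattice_walk
begin

text \<open>Only coordinate 0 is expanded in characters. Frequency 0 gives \<open>1 / d\<close>;
  frequency \<open>h\<close>, at distance \<open>N\<close> from 1, contributes at most
  \<open>2 / (\<delta> * sqrt i * N)\<close> before the division by \<open>d\<close>, and
  \<open>N\<close> is at least \<open>min h (d - h) / d\<close>.\<close>

lemma prob_dvd_visits_le:
  assumes d: "0 < d" and i: "0 < i"
  shows "prob {\<omega> \<in> space M. d dvd visits W i \<omega> 0} \<le> 1 / real d + 4 * harm d / (\<delta> * sqrt i)"
proof -
  define u where "u h m = (if m = 0 then unity_root d h else 1)" for h m :: nat
  have [measurable]: "{\<omega> \<in> space M. d dvd visits W i \<omega> 0} \<in> events" by measurable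
  have int: "integrable M (\<lambda>\<omega>. \<Prod>s\<in>{1..i}. u h (W s \<omega>))" for h
    by (intro integrable_const_bound[where B = 1] borel_measurable_prod step_compose_measurable)
      (auto simp: u_def simp flip: prod_norm intro!: prod_le_1)
  have eq: "complex_of_real (indicator {\<omega> \<in> space M. d dvd visits W i \<omega> 0} \<omega>)
      = (\<Sum>h<d. \<Prod>s\<in>{1..i}. u h (W s \<omega>)) / of_nat d" if "\<omega> \<in> space M" for \<omega>
  proof -
    have "(\<Sum>h<d. \<Prod>s\<in>{1..i}. u h (W s \<omega>)) = (\<Sum>h<d. unity_root d h ^ visits W i \<omega> 0)"
      unfolding power_visits u_def ..
    then show ?thesis using d that by (simp add: sum_unity_root_power)
  qed
  have "complex_of_real (prob {\<omega> \<in> space M. d dvd visits W i \<omega> 0})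
      = expectation (\<lambda>\<omega>. complex_of_real (indicator {\<omega> \<in> space M. d dvd visits W i \<omega> 0} \<omega>))"
    by simp
  also have "\<dots> = expectation (\<lambda>\<omega>. (\<Sum>h<d. \<Prod>s\<in>{1..i}. u h (W s \<omega>)) / of_nat d)"
    by (intro Bochner_Integration.integral_cong refl eq)
  also have "\<dots> = (\<Sum>h<d. expectation (\<lambda>\<omega>. \<Prod>s\<in>{1..i}. u h (W s \<omega>))) / of_nat d"
    using int by simp
  finally have c: "complex_of_real (prob {\<omega> \<in> space M. d dvd visits W i \<omega> 0})
      = (\<Sum>h<d. expectation (\<lambda>\<omega>. \<Prod>s\<in>{1..i}. u h (W s \<omega>))) / of_nat d" .
  have "prob {\<omega> \<in> space M. d dvd visits W i \<omega> 0}
      = norm (\<Sum>h<d. expectation (\<lambda>\<omega>. \<Prod>s\<in>{1..i}. u h (W s \<omega>))) / real d"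
    using arg_cong[OF c, of norm] by (simp only: norm_divide norm_of_real norm_of_nat abs_of_nonneg[OF measure_nonneg])
  also have "\<dots> \<le> (\<Sum>h<d. norm (expectation (\<lambda>\<omega>. \<Prod>s\<in>{1..i}. u h (W s \<omega>)))) / real d"
    by (intro divide_right_mono norm_sum) auto
  also have "(\<Sum>h<d. norm (expectation (\<lambda>\<omega>. \<Prod>s\<in>{1..i}. u h (W s \<omega>))))
      = 1 + (\<Sum>h\<in>{0<..<d}. norm (expectation (\<lambda>\<omega>. \<Prod>s\<in>{1..i}. u h (W s \<omega>))))"
  proof -
    have "{..<d} = insert 0 {0<..<d}" using d by auto
    moreover have "u 0 = (\<lambda>_. 1)" by (auto simp: u_def unity_root_def)
    ultimately show ?thesis by (simp add: prob_space)
  qed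
  also have "(\<Sum>h\<in>{0<..<d}. norm (expectation (\<lambda>\<omega>. \<Prod>s\<in>{1..i}. u h (W s \<omega>))))
      \<le> (\<Sum>h\<in>{0<..<d}. 2 * real d / (\<delta> * sqrt i) * (1 / real h + 1 / real (d - h)))"
  proof (rule sum_mono)
    fix h assume h: "h \<in> {0<..<d}"
    define N where "N = norm (unity_root d h - 1)"
    define x where "x = real i * (\<delta>\<^sup>2 * N\<^sup>2 / 4)"
    have mN: "min (real h) (real (d - h)) / real d \<le> N"
      unfolding N_def using h by (intro norm_unity_root_minus_one) auto
    have mpos: "0 < min (real h) (real (d - h)) / real d" using h by (auto simp: of_nat_diff)
    then have N: "0 < N" using mN by linarith
    \<comment> \<open>The contraction compares coordinate 0 with coordinate 1, where
      \<open>u h\<close> equals 1; the latter exists because \<open>k >= 2\<close>.\<close>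
    have "norm (expectation (\<lambda>\<omega>. \<Prod>s\<in>{1..i}. u h (W s \<omega>)))
        \<le> (1 - \<delta>\<^sup>2 * (norm (u h 0 - u h 1))\<^sup>2 / 4) ^ card {1..i}"
      using k_ge_2 by (intro norm_expectation_prod_steps_le) (auto simp: u_def)
    also have "\<dots> = (1 - \<delta>\<^sup>2 * N\<^sup>2 / 4) ^ i" by (simp add: u_def N_def)
    also have "\<dots> \<le> exp (- (\<delta>\<^sup>2 * N\<^sup>2 / 4)) ^ i"
    proof (rule power_mono)
      show "1 - \<delta>\<^sup>2 * N\<^sup>2 / 4 \<le> exp (- (\<delta>\<^sup>2 * N\<^sup>2 / 4))"
        using exp_ge_add_one_self[of "- (\<delta>\<^sup>2 * N\<^sup>2 / 4)"] by linarith
      have "N \<le> 2" using norm_triangle_ineq4[of "unity_root d h" 1] by (simp add: N_def)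
      then have "\<delta>\<^sup>2 * N\<^sup>2 \<le> 1\<^sup>2 * 2\<^sup>2"
        using N \<delta>_pos \<delta>_le_1 by (intro mult_mono power_mono) auto
      then show "0 \<le> 1 - \<delta>\<^sup>2 * N\<^sup>2 / 4" by simp
    qed
    also have "\<dots> = exp (- x)" by (simp add: x_def flip: exp_of_nat_mult)
    also have "\<dots> \<le> 1 / sqrt x"
      using N \<delta>_pos i by (intro exp_minus_le_inverse_sqrt) (simp add: x_def)
    also have "sqrt x = \<delta> * sqrt i / 2 * N"
      using N \<delta>_pos by (simp add: x_def real_sqrt_mult real_sqrt_divide)
    also have "1 / (\<delta> * sqrt i / 2 * N) = 2 / (\<delta> * sqrt i) * (1 / N)" by simp
    also have "\<dots> \<le> 2 / (\<delta> * sqrt i) * (real d * (1 / real h + 1 / real (d - h)))"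
    proof (rule mult_left_mono)
      have "1 / N \<le> 1 / (min (real h) (real (d - h)) / real d)"
        using mN by (rule divide_left_mono) (simp_all only: mult_pos_pos[OF N mpos] zero_le_one)
      also have "\<dots> = real d * (1 / min (real h) (real (d - h)))" by simp
      also have "\<dots> \<le> real d * (1 / real h + 1 / real (d - h))"
        by (intro mult_left_mono) (auto simp: min_def)
      finally show "1 / N \<le> real d * (1 / real h + 1 / real (d - h))" .
    qed (use \<delta>_pos in auto)
    finally show "norm (expectation (\<lambda>\<omega>. \<Prod>s\<in>{1..i}. u h (W s \<omega>)))
        \<le> 2 * real d / (\<delta> * sqrt i) * (1 / real h + 1 / real (d - h))" by (simp add: mult_ac)
  qed
  also have "\<dots> \<le> 2 * real d / (\<delta> * sqrt i) * (2 * harm d)"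
    unfolding sum_distrib_left[symmetric]
    using \<delta>_pos by (intro mult_left_mono sum_inverse_reflect_le_harm) auto
  finally have "prob {\<omega> \<in> space M. d dvd visits W i \<omega> 0}
      \<le> (1 + 2 * real d / (\<delta> * sqrt i) * (2 * harm d)) / real d"
    by (simp add: divide_right_mono)
  also have "\<dots> = 1 / real d + 4 * harm d / (\<delta> * sqrt i)"
    using d by (simp add: add_divide_distrib)
  finally show ?thesis .
qed

lemma integrable_dvd_freq: "integrable M (dvd_freq k d W n)"
  by (intro integrable_const_bound[where B = 1]) (simp_all add: dvd_freq_nonneg dvd_freq_le_1)

text \<open>If \<open>d\<close> divides all coordinates, it divides their sum \<open>i\<close>.
  Restricting to such times gains a factor of about \<open>1 / d\<close> on top of the probability
  for coordinate 0.\<close>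

lemma expectation_dvd_freq_le:
  "expectation (dvd_freq k d W n)
    \<le> (\<Sum>i | i \<in> {1..n} \<and> d dvd i. prob {\<omega> \<in> space M. d dvd visits W i \<omega> 0}) / real n"
proof -
  have [measurable]: "{\<omega> \<in> space M. d dvd visits W i \<omega> 0} \<in> events" for i by measurable
  let ?f = "\<lambda>\<omega>. (\<Sum>i | i \<in> {1..n} \<and> d dvd i. indicator {\<omega> \<in> space M. d dvd visits W i \<omega> 0} \<omega>) / real n"
  have "AE \<omega> in M. dvd_freq k d W n \<omega> \<le> ?f \<omega>"
    using AE_visits_sum AE_space
  proof eventually_elim
    case (elim \<omega>)
    have "dvd_visits k d W i \<omega> \<Longrightarrow> d dvd i" for i
      using dvd_sum[of "{..<k}" d "visits W i \<omega>"] elim by (auto simp: dvd_visits_def)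
    then have "(\<Sum>i\<in>{1..n}. of_bool (dvd_visits k d W i \<omega>) :: real)
        = (\<Sum>i | i \<in> {1..n} \<and> d dvd i. of_bool (dvd_visits k d W i \<omega>))"
      by (intro sum.mono_neutral_right) auto
    also have "\<dots> \<le> (\<Sum>i | i \<in> {1..n} \<and> d dvd i. indicator {\<omega> \<in> space M. d dvd visits W i \<omega> 0} \<omega>)"
      using elim k_ge_2 by (intro sum_mono) (auto simp: dvd_visits_def)
    finally show ?case unfolding dvd_freq_def by (rule divide_right_mono) simp
  qed
  moreover note integrable_dvd_freq
  moreover have int: "integrable M (indicator {\<omega> \<in> space M. d dvd visits W i \<omega> 0} :: 'a \<Rightarrow> real)" for i
    by (simp add: integrable_indicator_iff less_top[symmetric])
  ultimately have "expectation (dvd_freq k d W n) \<le> expectation ?f"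
    by (intro integral_mono_AE) auto
  also have "\<dots> = (\<Sum>i | i \<in> {1..n} \<and> d dvd i. prob {\<omega> \<in> space M. d dvd visits W i \<omega> 0}) / real n"
    using int by simp
  finally show ?thesis .
qed

end

text \<open>
  The cutoff \<open>m\<^sup>4\<close> separates the divisors handled by equidistribution from those for which only an
  upper bound is available; in the second sum the negligible terms \<open>1 / d\<^sup>k\<close> are dropped.
\<close>
definition dvd_error :: "nat \<Rightarrow> (nat \<Rightarrow> 'a \<Rightarrow> nat) \<Rightarrow> nat \<Rightarrow> 'a \<Rightarrow> real" where
  "dvd_error k W m \<omega> = (\<Sum>d\<in>{1..m ^ 4}. \<bar>dvd_freq k d W (m ^ 32) \<omega> - 1 / real d ^ k\<bar>)
    + (\<Sum>d\<in>{m ^ 4<..m ^ 32}. dvd_freq k d W (m ^ 32) \<omega>)"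

lemma dvd_error_nonneg: "0 \<le> dvd_error k W m \<omega>"
  by (simp add: dvd_error_def sum_nonneg dvd_freq_nonneg)

section \<open>Summable error bounds along the times \<open>m ^ 32\<close>\<close>

context lattice_walk
begin

text \<open>Multiples of \<open>d\<close> have density at most \<open>1 / d\<close>, and summing
  this over \<open>d\<close> costs a harmonic number of order \<open>m\<close>. At late times the
  divisibility probability is at most \<open>B\<close>, of order \<open>m^(-4)\<close>, which leaves
  order \<open>m^(-3)\<close>.\<close>

lemma expectation_large_dvd_freq_le:
  assumes m: "0 < m"
  shows "(\<Sum>d\<in>{m ^ 4<..m ^ 32}. expectation (dvd_freq k d W (m ^ 32))) \<le> 5000 / (\<delta> * real m ^ 2)"
proof -
  define n where "n = m ^ 32"
  \<comment> \<open>With this cutoff \<open>L * L / n = m^(-8)\<close>, while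
    \<open>sqrt i >= m^6\<close> for later times outweighs the factor \<open>m\<close> in the
    harmonic bound.\<close>
  define L where "L = m ^ 12"
  \<comment> \<open>Here 133 is 1, from \<open>1 / d\<close> with \<open>d > m^4\<close>, plus 132 =
    4 * 33, from the harmonic term with \<open>harm n <= 33 * m\<close>.\<close>
  define B where "B = 133 / (\<delta> * real m ^ 4)"
  let ?p = "\<lambda>d i. prob {\<omega> \<in> space M. d dvd visits W i \<omega> 0}"
  have n0: "0 < n" and m1: "1 \<le> real m" using m by (simp_all add: n_def)
  have B0: "0 \<le> B" using \<delta>_pos by (simp add: B_def)
  have harm: "harm n \<le> 33 * real m"
  proof -
    have "harm n \<le> 1 + ln (real n)" by (rule harm_le_one_plus_ln[OF n0])
    also have "ln (real n) = 32 * ln (real m)" using m by (simp add: n_def ln_realpow)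
    also have "ln (real m) \<le> real m - 1" using m by (intro ln_le_minus_one) simp
    finally show ?thesis using m1 by simp
  qed
  have p_le: "?p d i \<le> of_bool (i \<le> L) + B" if d: "d \<in> {m ^ 4<..n}" and i: "0 < i" for d i
  proof (cases "i \<le> L")
    case True
    have "?p d i \<le> 1" by (rule prob_le_1)
    also have "1 \<le> of_bool (i \<le> L) + B" using True B0 by simp
    finally show ?thesis .
  next
    case False
    have "real m ^ 6 = sqrt (real L)"
      by (rule real_sqrt_unique[symmetric]) (simp_all add: L_def flip: power_mult)
    also have "\<dots> \<le> sqrt (real i)" using False by simp
    finally have sq: "real m ^ 6 \<le> sqrt (real i)" .
    have "harm d \<le> (harm n :: real)" unfolding harm_def using d by (intro sum_mono2) auto
    with harm have hd: "harm d \<le> 33 * real m" by linarith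
    have d4: "real m ^ 4 \<le> real d" using d by (simp flip: of_nat_power)
    have "?p d i \<le> 1 / real d + 4 * harm d / (\<delta> * sqrt i)"
      using d i by (intro prob_dvd_visits_le) auto
    also have "1 / real d \<le> 1 / real m ^ 4"
      using d4 m d by (intro divide_left_mono) auto
    also have "1 / real m ^ 4 \<le> 1 / (\<delta> * real m ^ 4)"
      using \<delta>_pos \<delta>_le_1 m by (intro divide_left_mono) (auto simp: mult_left_le_one_le)
    also have "4 * harm d / (\<delta> * sqrt i) \<le> 4 * (33 * real m) / (\<delta> * real m ^ 6)"
      using hd sq \<delta>_pos m by (intro frac_le mult_left_mono mult_pos_pos) auto
    also have "\<dots> = 132 * (real m / real m ^ 6) / \<delta>" by simp
    also have "real m / real m ^ 6 = 1 / real m ^ 5"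
      using m by (simp add: power_eq_if[of _ 6])
    also have "132 * (1 / real m ^ 5) / \<delta> \<le> 132 * (1 / real m ^ 4) / \<delta>"
      using \<delta>_pos m m1 by (intro divide_right_mono mult_left_mono divide_left_mono power_increasing) auto
    finally have "?p d i \<le> 1 / (\<delta> * real m ^ 4) + 132 * (1 / real m ^ 4) / \<delta>" by simp
    also have "\<dots> = B" by (simp add: B_def field_simps)
    finally show ?thesis using False by simp
  qed
  have "(\<Sum>d\<in>{m ^ 4<..n}. expectation (dvd_freq k d W n))
      \<le> (\<Sum>d\<in>{m ^ 4<..n}. (\<Sum>i | i \<in> {1..n} \<and> d dvd i. ?p d i) / real n)"
    by (intro sum_mono expectation_dvd_freq_le)
  also have "\<dots> \<le> (\<Sum>d\<in>{m ^ 4<..n}. (\<Sum>i | i \<in> {1..n} \<and> d dvd i. of_bool (i \<le> L) + B) / real n)"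
    by (intro sum_mono divide_right_mono p_le) auto
  \<comment> \<open>the early times \<open>i \<le> L\<close> are so few that the trivial bound 1 suffices there\<close>
  also have "\<dots> = (\<Sum>d\<in>{m ^ 4<..n}. \<Sum>i | i \<in> {1..n} \<and> d dvd i. of_bool (i \<le> L)) / real n
      + B * (\<Sum>d\<in>{m ^ 4<..n}. real (card {i \<in> {1..n}. d dvd i})) / real n"
    by (simp add: sum.distrib add_divide_distrib sum_divide_distrib sum_distrib_left mult_ac)
  \<comment> \<open>From \<open>d dvd i\<close> and \<open>i <= L\<close> follows
    \<open>d <= L\<close>, so at most \<open>L * L\<close> pairs occur.\<close>
  also have "(\<Sum>d\<in>{m ^ 4<..n}. \<Sum>i | i \<in> {1..n} \<and> d dvd i. of_bool (i \<le> L)) \<le> real L * real L"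
  proof -
    have "(\<Sum>i | i \<in> {1..n} \<and> d dvd i. of_bool (i \<le> L) :: real) \<le> (if d \<le> L then real L else 0)" for d
    proof -
      have "(\<Sum>i | i \<in> {1..n} \<and> d dvd i. of_bool (i \<le> L) :: real)
          \<le> (\<Sum>i\<in>{1..n}. if i \<le> L then of_bool (d \<le> L) else 0)"
        by (rule order_trans[OF sum_mono sum_mono2]) (auto dest: dvd_imp_le)
      also have "\<dots> = (\<Sum>i\<in>{1..n} \<inter> {i. i \<le> L}. of_bool (d \<le> L))"
        by (simp add: sum.If_cases)
      also have "\<dots> \<le> (\<Sum>i\<in>{1..L}. of_bool (d \<le> L))"
        by (intro sum_mono2) auto
      also have "\<dots> = (if d \<le> L then real L else 0)" by simp
      finally show ?thesis .
    qed
    then have "(\<Sum>d\<in>{m ^ 4<..n}. \<Sum>i | i \<in> {1..n} \<and> d dvd i. of_bool (i \<le> L) :: real)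
        \<le> (\<Sum>d\<in>{m ^ 4<..n}. if d \<le> L then real L else 0)"
      by (rule sum_mono)
    also have "\<dots> = (\<Sum>d\<in>{m ^ 4<..n} \<inter> {d. d \<le> L}. real L)" by (simp add: sum.If_cases)
    also have "\<dots> \<le> (\<Sum>d\<in>{1..L}. real L)" by (intro sum_mono2) auto
    finally show ?thesis by simp
  qed
  also have "(\<Sum>d\<in>{m ^ 4<..n}. real (card {i \<in> {1..n}. d dvd i})) \<le> real n * (33 * real m)"
  proof -
    have "(\<Sum>d\<in>{m ^ 4<..n}. real (card {i \<in> {1..n}. d dvd i})) \<le> (\<Sum>d\<in>{m ^ 4<..n}. real n / real d)"
      by (intro sum_mono card_multiples_le) auto
    also have "\<dots> \<le> (\<Sum>d\<in>{1..n}. real n / real d)" by (intro sum_mono2) auto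
    also have "\<dots> = real n * harm n" by (simp add: harm_def sum_distrib_left divide_inverse)
    also have "\<dots> \<le> real n * (33 * real m)" by (intro mult_left_mono harm) simp
    finally show ?thesis .
  qed
  finally have "(\<Sum>d\<in>{m ^ 4<..n}. expectation (dvd_freq k d W n))
      \<le> real L * real L / real n + B * (real n * (33 * real m)) / real n"
    using B0 by (simp add: divide_right_mono mult_left_mono)
  \<comment> \<open>The constant is 4389 = 133 * 33; with the early times it makes 4390, later
    rounded up to 5000.\<close>
  also have "\<dots> = 1 / real m ^ 8 + 4389 / (\<delta> * real m ^ 3)"
  proof -
    have "real L * real L * real m ^ 8 = real n" by (simp add: L_def n_def flip: power_add)
    then have "real L * real L / real n = 1 / real m ^ 8" using m n0 by (simp add: field_simps)
    moreover have "B * (real n * (33 * real m)) / real n = 4389 / (\<delta> * real m ^ 3)"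
      using n0 m by (simp add: B_def power_eq_if[of _ 4])
    ultimately show ?thesis by simp
  qed
  also have "\<dots> \<le> 1 / (\<delta> * real m ^ 2) + 4389 / (\<delta> * real m ^ 2)"
  proof (intro add_mono divide_left_mono)
    have "\<delta> * real m ^ 2 \<le> 1 * real m ^ 8"
      using \<delta>_pos \<delta>_le_1 m1 by (intro mult_mono power_increasing) auto
    then show "\<delta> * real m ^ 2 \<le> real m ^ 8" by simp
    show "\<delta> * real m ^ 2 \<le> \<delta> * real m ^ 3"
      using \<delta>_pos m1 by (intro mult_left_mono power_increasing) auto
  qed (use \<delta>_pos m in auto)
  also have "\<dots> \<le> 5000 / (\<delta> * real m ^ 2)"
    using \<delta>_pos m by (simp add: divide_right_mono flip: add_divide_distrib)
  finally show ?thesis by (simp add: n_def)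
qed

lemma integrable_dvd_error: "integrable M (dvd_error k W m)"
  unfolding dvd_error_def[abs_def]
  by (intro Bochner_Integration.integrable_add Bochner_Integration.integrable_sum integrable_abs
      Bochner_Integration.integrable_diff integrable_dvd_freq integrable_const)

text \<open>Since \<open>sqrt (m^32) = m^16\<close>, each of the \<open>m^4\<close> small divisors
  contributes at most \<open>3 * m^4 / (\<delta> * m^16)\<close>, of order \<open>m^(-8)\<close> in
  total; the large divisors dominate.\<close>

lemma expectation_dvd_error_le:
  assumes m: "0 < m"
  shows "expectation (dvd_error k W m) \<le> 5003 / (\<delta> * real m ^ 2)"
proof -
  have m1: "1 \<le> real m" using m by simp
  have sq: "sqrt (real (m ^ 32)) = real m ^ 16"
    by (rule real_sqrt_unique) (simp_all flip: power_mult)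
  have "expectation (dvd_error k W m)
      = (\<Sum>d\<in>{1..m ^ 4}. expectation (\<lambda>\<omega>. \<bar>dvd_freq k d W (m ^ 32) \<omega> - 1 / real d ^ k\<bar>))
      + (\<Sum>d\<in>{m ^ 4<..m ^ 32}. expectation (dvd_freq k d W (m ^ 32)))"
    unfolding dvd_error_def[abs_def] using integrable_dvd_freq by simp
  also have "(\<Sum>d\<in>{1..m ^ 4}. expectation (\<lambda>\<omega>. \<bar>dvd_freq k d W (m ^ 32) \<omega> - 1 / real d ^ k\<bar>))
      \<le> (\<Sum>d\<in>{1..m ^ 4}. 3 * real m ^ 4 / (\<delta> * real m ^ 16))"
  proof (rule sum_mono)
    fix d assume d: "d \<in> {1..m ^ 4}"
    have "expectation (\<lambda>\<omega>. \<bar>dvd_freq k d W (m ^ 32) \<omega> - 1 / real d ^ k\<bar>)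
        \<le> 3 * real d / (\<delta> * real m ^ 16)"
      using expectation_dvd_freq_dist_le[of d "m ^ 32"] d m by (simp only: sq) simp
    also have "\<dots> \<le> 3 * real m ^ 4 / (\<delta> * real m ^ 16)"
      using d \<delta>_pos by (intro divide_right_mono mult_left_mono) (auto simp flip: of_nat_power)
    finally show "expectation (\<lambda>\<omega>. \<bar>dvd_freq k d W (m ^ 32) \<omega> - 1 / real d ^ k\<bar>)
        \<le> 3 * real m ^ 4 / (\<delta> * real m ^ 16)" .
  qed
  also have "\<dots> = 3 * real m ^ 8 / (\<delta> * real m ^ 16)"
    by (simp add: mult_ac flip: power_add)
  also have "\<dots> = 3 * (1 / (\<delta> * real m ^ 8))"
  proof -
    define x where "x = real m ^ 8"
    have "real m ^ 16 = x * x" by (simp add: x_def flip: power_add)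
    moreover have "x \<noteq> 0" using m by (simp add: x_def)
    ultimately show ?thesis by (simp add: x_def[symmetric])
  qed
  also have "\<dots> \<le> 3 * (1 / (\<delta> * real m ^ 2))"
    using \<delta>_pos m m1 by (intro mult_left_mono divide_left_mono power_increasing) auto
  also note expectation_large_dvd_freq_le[OF m]
  finally have "expectation (dvd_error k W m) \<le> 3 * (1 / (\<delta> * real m ^ 2)) + 5000 / (\<delta> * real m ^ 2)" by simp
  also have "\<dots> = 5003 / (\<delta> * real m ^ 2)" by (simp flip: add_divide_distrib)
  finally show ?thesis .
qed

text \<open>The expectations are summable, so the series of errors has finite expectation, is finite
  almost surely, and its terms tend to 0. The index \<open>Suc m\<close> avoids the bound at
  \<open>m = 0\<close>.\<close>

lemma AE_dvd_error_tendsto: "AE \<omega> in M. (\<lambda>m. dvd_error k W (Suc m) \<omega>) \<longlonglongrightarrow> 0"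
proof -
  let ?b = "\<lambda>m. 5003 / \<delta> * (1 / real (Suc m) ^ 2)"
  have [measurable]: "dvd_error k W m \<in> borel_measurable M" for m
    using integrable_dvd_error by auto
  have sum: "summable ?b"
    using inverse_power_summable[of 2, where 'a = real]
    by (intro summable_mult) (subst summable_Suc_iff, simp add: inverse_eq_divide)
  have "(\<integral>\<^sup>+\<omega>. (\<Sum>m. ennreal (dvd_error k W (Suc m) \<omega>)) \<partial>M) = (\<Sum>m. \<integral>\<^sup>+\<omega>. ennreal (dvd_error k W (Suc m) \<omega>) \<partial>M)"
    by (rule nn_integral_suminf) measurable
  also have "\<dots> = (\<Sum>m. ennreal (expectation (dvd_error k W (Suc m))))"
    by (intro suminf_cong nn_integral_eq_integral integrable_dvd_error) (simp add: dvd_error_nonneg)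
  also have "\<dots> \<le> (\<Sum>m. ennreal (?b m))"
  proof (intro suminf_le ennreal_leI)
    show "expectation (dvd_error k W (Suc m)) \<le> ?b m" for m
      using expectation_dvd_error_le[OF zero_less_Suc, of m]
      by (simp only: divide_divide_eq_left times_divide_eq_right mult_1_right)
  qed auto
  also have "\<dots> = ennreal (\<Sum>m. ?b m)"
    using \<delta>_pos sum by (intro suminf_ennreal2) auto
  finally have "(\<integral>\<^sup>+\<omega>. (\<Sum>m. ennreal (dvd_error k W (Suc m) \<omega>)) \<partial>M) \<noteq> \<infinity>"
    using ennreal_less_top order_le_less_trans by (metis infinity_ennreal_def less_irrefl)
  then have "AE \<omega> in M. (\<Sum>m. ennreal (dvd_error k W (Suc m) \<omega>)) \<noteq> \<infinity>"
    by (intro nn_integral_PInf_AE) auto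
  then show ?thesis
  proof eventually_elim
    case (elim \<omega>)
    then have "summable (\<lambda>m. dvd_error k W (Suc m) \<omega>)"
      by (intro summable_suminf_not_top) (auto simp: dvd_error_nonneg)
    then show ?case by (rule summable_LIMSEQ_zero)
  qed
qed

end

section \<open>Euler product and sieve\<close>

lemma summable_on_inverse_power:
  fixes A :: "nat set"
  assumes "2 \<le> k"
  shows "(\<lambda>n. 1 / real n ^ k) summable_on A"
proof (rule summable_on_subset)
  show "(\<lambda>n. 1 / real n ^ k) summable_on UNIV"
    using inverse_power_summable[OF assms, where 'a = real]
    by (intro norm_summable_imp_summable_on) (simp add: inverse_eq_divide)
qed simp

text \<open>The unordered sum lets the index set be split and rescaled freely, as the Euler product
  requires.\<close>

lemma zeta_nat_eq_infsum:
  assumes "2 \<le> k"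
  shows "zeta_nat k = (\<Sum>\<^sub>\<infinity>n\<in>{1..}. 1 / real n ^ k)"
proof -
  have "summable (\<lambda>n. 1 / real (Suc n) ^ k)"
    using inverse_power_summable[OF assms, where 'a = real]
    by (subst summable_Suc_iff) (simp add: inverse_eq_divide)
  then have "((\<lambda>n. 1 / real (Suc n) ^ k) has_sum zeta_nat k) UNIV"
    unfolding zeta_nat_def by (intro norm_summable_imp_has_sum summable_sums) simp_all
  then have "zeta_nat k = (\<Sum>\<^sub>\<infinity>n. 1 / real (Suc n) ^ k)" by (simp add: infsumI)
  also have "\<dots> = (\<Sum>\<^sub>\<infinity>n\<in>{1..}. 1 / real n ^ k)"
    by (rule infsum_reindex_bij_betw)
      (auto simp: bij_betw_def image_iff dest: Suc_le_D)
  finally show ?thesis .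
qed

text \<open>Multiplying by \<open>1 - 1 / p^k\<close> deletes the multiples of \<open>p\<close>:
  among the integers free of primes in \<open>P\<close>, those divisible by a new prime
  \<open>p\<close> are exactly \<open>p\<close> times the integers free of primes in
  \<open>P\<close>.\<close>

lemma zeta_nat_times_euler_product:
  assumes k: "2 \<le> k" and P: "finite P" "\<And>p. p \<in> P \<Longrightarrow> prime p"
  shows "zeta_nat k * (\<Prod>p\<in>P. 1 - 1 / real p ^ k)
    = (\<Sum>\<^sub>\<infinity>n\<in>{n. 1 \<le> n \<and> (\<forall>p\<in>P. \<not> p dvd n)}. 1 / real n ^ k)"
  using P
proof (induction P rule: finite_induct)
  case empty
  have "{n::nat. 1 \<le> n} = {1..}" by auto
  then show ?case using k by (simp add: zeta_nat_eq_infsum)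
next
  case (insert p P)
  define f where "f n = 1 / real n ^ k" for n
  define A where "A Q = {n::nat. 1 \<le> n \<and> (\<forall>p\<in>Q. \<not> p dvd n)}" for Q
  have sum: "f summable_on S" for S unfolding f_def by (rule summable_on_inverse_power[OF k])
  have p: "prime p" and p0: "0 < p" using insert.prems prime_gt_0_nat by auto
  have ndvd: "q dvd p * n \<longleftrightarrow> q dvd n" if "q \<in> P" for q n
  proof -
    have "\<not> q dvd p" using that insert.prems insert.hyps by (metis insertCI primes_dvd_imp_eq)
    then show ?thesis using that insert.prems by (simp add: prime_dvd_mult_iff)
  qed
  have split: "A P = A (insert p P) \<union> (*) p ` A P"
  proof (intro equalityI subsetI)
    fix n assume n: "n \<in> A P"
    show "n \<in> A (insert p P) \<union> (*) p ` A P"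
    proof (cases "p dvd n")
      case True
      then obtain t where t: "n = p * t" by (elim dvdE)
      then have "t \<in> A P" using n ndvd by (cases "t = 0") (auto simp: A_def)
      then show ?thesis using t by auto
    qed (use n in \<open>auto simp: A_def\<close>)
  qed (use ndvd p0 in \<open>auto simp: A_def\<close>)
  have "infsum f (A P) = infsum f (A (insert p P)) + infsum f ((*) p ` A P)"
    by (subst split, rule infsum_Un_disjoint[OF sum sum]) (auto simp: A_def)
  also have "infsum f ((*) p ` A P) = infsum (\<lambda>n. 1 / real p ^ k * f n) (A P)"
    using p0 by (subst infsum_reindex) (auto simp: inj_on_def o_def f_def power_mult_distrib)
  also have "\<dots> = 1 / real p ^ k * infsum f (A P)" by (rule infsum_cmult_right')
  finally have "infsum f (A (insert p P)) = infsum f (A P) * (1 - 1 / real p ^ k)"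
    by algebra
  moreover have "zeta_nat k * (\<Prod>p\<in>P. 1 - 1 / real p ^ k) = infsum f (A P)"
    unfolding A_def f_def using insert.prems by (intro insert.IH) auto
  ultimately have "zeta_nat k * (\<Prod>p\<in>insert p P. 1 - 1 / real p ^ k) = infsum f (A (insert p P))"
    unfolding prod.insert[OF insert.hyps] by algebra
  then show ?case by (simp only: A_def f_def[abs_def])
qed

lemma infsum_greaterThan_tendsto_0:
  assumes "2 \<le> k"
  shows "(\<lambda>D. \<Sum>\<^sub>\<infinity>n\<in>{D<..}. 1 / real n ^ k) \<longlonglongrightarrow> 0"
proof -
  have eq: "(\<Sum>\<^sub>\<infinity>n\<in>{D<..}. 1 / real n ^ k) = zeta_nat k - (\<Sum>n<D. 1 / real (Suc n) ^ k)" for D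
  proof -
    have "{1..} = {1..D} \<union> {D<..}" by auto
    then have "zeta_nat k = (\<Sum>\<^sub>\<infinity>n\<in>{1..D} \<union> {D<..}. 1 / real n ^ k)"
      using zeta_nat_eq_infsum[OF assms] by simp
    also have "\<dots> = (\<Sum>\<^sub>\<infinity>n\<in>{1..D}. 1 / real n ^ k) + (\<Sum>\<^sub>\<infinity>n\<in>{D<..}. 1 / real n ^ k)"
      by (rule infsum_Un_disjoint) (auto intro: summable_on_inverse_power assms)
    also have "(\<Sum>\<^sub>\<infinity>n\<in>{1..D}. 1 / real n ^ k) = (\<Sum>n<D. 1 / real (Suc n) ^ k)"
      by (simp add: sum.atLeast1_atMost_eq)
    finally show ?thesis by simp
  qed
  have "summable (\<lambda>n. 1 / real (Suc n) ^ k)"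
    using inverse_power_summable[OF assms, where 'a = real]
    by (subst summable_Suc_iff) (simp add: inverse_eq_divide)
  from summable_LIMSEQ[OF this] have "(\<lambda>D. zeta_nat k - (\<Sum>n<D. 1 / real (Suc n) ^ k)) \<longlonglongrightarrow> zeta_nat k - zeta_nat k"
    unfolding zeta_nat_def by (intro tendsto_diff tendsto_const)
  then show ?thesis by (simp add: eq)
qed

lemma zeta_nat_ge_1:
  assumes "2 \<le> k"
  shows "1 \<le> zeta_nat k"
proof -
  have "(\<Sum>\<^sub>\<infinity>n\<in>{1}. 1 / real n ^ k) \<le> (\<Sum>\<^sub>\<infinity>n\<in>{1..}. 1 / real n ^ k)"
    by (rule infsum_mono2) (auto intro: summable_on_inverse_power assms)
  then show ?thesis using zeta_nat_eq_infsum[OF assms] by simp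
qed

text \<open>Every \<open>n > 1\<close> without prime factors up to \<open>D\<close> exceeds
  \<open>D\<close>, so \<zeta> times the partial product differs from 1 by at most the tail.
  Dividing by \<open>zeta_nat k >= 1\<close> can only shrink the difference.\<close>

lemma euler_product_dist_le:
  assumes k: "2 \<le> k"
  shows "\<bar>(\<Prod>p | prime p \<and> p \<le> D. 1 - 1 / real p ^ k) - 1 / zeta_nat k\<bar> \<le> (\<Sum>\<^sub>\<infinity>n\<in>{D<..}. 1 / real n ^ k)"
proof -
  define Q where "Q = (\<Prod>p | prime p \<and> p \<le> D. 1 - 1 / real p ^ k)"
  define A where "A = {n::nat. 1 \<le> n \<and> (\<forall>p\<in>{p. prime p \<and> p \<le> D}. \<not> p dvd n)}"
  have summ: "(\<lambda>n. 1 / real n ^ k) summable_on S" for S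
    by (rule summable_on_inverse_power[OF k])
  have "finite {p::nat. prime p \<and> p \<le> D}" by (rule finite_subset[of _ "{..D}"]) auto
  then have zQ: "zeta_nat k * Q = (\<Sum>\<^sub>\<infinity>n\<in>A. 1 / real n ^ k)"
    unfolding Q_def A_def by (intro zeta_nat_times_euler_product k) auto
  have sub: "A - {1} \<subseteq> {D<..}"
  proof
    fix n assume n: "n \<in> A - {1}"
    then obtain p where "prime p" "p dvd n" using prime_factor_nat[of n] by auto
    then show "n \<in> {D<..}" using n dvd_imp_le[of p n] by (auto simp: A_def not_le)
  qed
  have "A = {1} \<union> (A - {1})" by (auto simp: A_def dest: prime_gt_1_nat)
  then have "(\<Sum>\<^sub>\<infinity>n\<in>A. 1 / real n ^ k) = (\<Sum>\<^sub>\<infinity>n\<in>{1} \<union> (A - {1}). 1 / real n ^ k)" by simp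
  also have "\<dots> = (\<Sum>\<^sub>\<infinity>n\<in>{1}. 1 / real n ^ k) + (\<Sum>\<^sub>\<infinity>n\<in>A - {1}. 1 / real n ^ k)"
    by (rule infsum_Un_disjoint[OF summ summ]) auto
  finally have zQ1: "zeta_nat k * Q - 1 = (\<Sum>\<^sub>\<infinity>n\<in>A - {1}. 1 / real n ^ k)" using zQ by simp
  have nonneg: "0 \<le> zeta_nat k * Q - 1" unfolding zQ1 by (intro infsum_nonneg) auto
  have z1: "1 \<le> zeta_nat k" by (rule zeta_nat_ge_1[OF k])
  have "\<bar>Q - 1 / zeta_nat k\<bar> = (zeta_nat k * Q - 1) / zeta_nat k"
  proof -
    have eq: "Q - 1 / zeta_nat k = (zeta_nat k * Q - 1) / zeta_nat k" using z1 by (simp add: field_simps)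
    show ?thesis unfolding eq using nonneg z1 by (intro abs_of_nonneg divide_nonneg_nonneg) auto
  qed
  also have "\<dots> \<le> (zeta_nat k * Q - 1) / 1" using nonneg z1 by (intro divide_left_mono) auto
  also have "\<dots> = (\<Sum>\<^sub>\<infinity>n\<in>A - {1}. 1 / real n ^ k)" using zQ1 by simp
  also have "\<dots> \<le> (\<Sum>\<^sub>\<infinity>n\<in>{D<..}. 1 / real n ^ k)"
    by (rule infsum_mono2[OF summ summ sub]) auto
  finally show ?thesis by (simp add: Q_def)
qed

section \<open>Sieving for visible points and passage to the limit\<close>

lemma prod_primes_dvd_iff:
  fixes n :: nat
  assumes "finite X" "\<And>p. p \<in> X \<Longrightarrow> prime p"
  shows "\<Prod>X dvd n \<longleftrightarrow> (\<forall>p\<in>X. p dvd n)"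
  using assms
proof (induction X rule: finite_induct)
  case (insert p X)
  have "coprime p (\<Prod>X)"
    using insert by (intro prod_coprime_right) (metis insertCI primes_coprime)
  then have "p * \<Prod>X dvd n \<longleftrightarrow> p dvd n \<and> \<Prod>X dvd n"
    by (metis divides_mult dvd_mult_left dvd_mult_right)
  then show ?case using insert by simp
qed simp

lemma walk_pos_eq_visits: "walk_pos W i \<omega> j = int (visits W i \<omega> j)"
  by (simp add: walk_pos_def visits_def)

lemma visible_imp_not_dvd_visits:
  assumes "visible k (walk_pos W i \<omega>)" "1 < d"
  shows "\<not> dvd_visits k d W i \<omega>"
proof
  assume "dvd_visits k d W i \<omega>"
  then have "int d dvd Gcd (walk_pos W i \<omega> ` {..<k})"
    by (intro Gcd_greatest) (auto simp: dvd_visits_def walk_pos_eq_visits)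
  then show False using assms by (simp add: visible_def)
qed

text \<open>Any prime factor of the gcd works. It divides the coordinate sum \<open>i > 0\<close>,
  so the primes that can spoil visibility are bounded by the time.\<close>

lemma not_visible_imp_prime_dvd_visits:
  assumes "\<not> visible k (walk_pos W i \<omega>)" "(\<Sum>j<k. visits W i \<omega> j) = i" "0 < i"
  shows "\<exists>p. prime p \<and> p \<le> i \<and> dvd_visits k p W i \<omega>"
proof -
  define g where "g = nat (Gcd (walk_pos W i \<omega> ` {..<k}))"
  have ig: "int g = Gcd (walk_pos W i \<omega> ` {..<k})" by (simp add: g_def)
  have dv: "dvd_visits k g W i \<omega>"
    unfolding dvd_visits_def
  proof (intro allI impI)
    fix j assume "j < k"
    then have "int g dvd walk_pos W i \<omega> j" unfolding ig by (intro Gcd_dvd) auto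
    then show "g dvd visits W i \<omega> j" by (simp add: walk_pos_eq_visits)
  qed
  have "g \<noteq> 1" using assms(1) ig by (auto simp: visible_def)
  then obtain p where p: "prime p" "p dvd g" using prime_factor_nat by blast
  have pv: "dvd_visits k p W i \<omega>" using dv p by (auto simp: dvd_visits_def intro: dvd_trans)
  then have "p dvd (\<Sum>j<k. visits W i \<omega> j)" by (intro dvd_sum) (auto simp: dvd_visits_def)
  then have "p \<le> i" using assms by (intro dvd_imp_le) auto
  then show ?thesis using p pv by auto
qed

text \<open>Inclusion-exclusion: the indicator is a product of terms 1 minus an indicator. Expanded
  over subsets \<open>X\<close> of \<open>P\<close>, joint divisibility by distinct primes is
  divisibility by their product.\<close>

lemma sieve_freq_eq:
  assumes P: "finite P" "\<And>p. p \<in> P \<Longrightarrow> prime p"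
  shows "(\<Sum>i\<in>{1..n}. of_bool (\<forall>p\<in>P. \<not> dvd_visits k p W i \<omega>)) / real n
    = (\<Sum>X\<in>Pow P. (-1) ^ card X * dvd_freq k (\<Prod>X) W n \<omega>)"
proof -
  have "(of_bool (\<forall>p\<in>P. \<not> dvd_visits k p W i \<omega>) :: real)
      = (\<Sum>X\<in>Pow P. (-1) ^ card X * of_bool (dvd_visits k (\<Prod>X) W i \<omega>))" for i
  proof -
    have "(of_bool (\<forall>p\<in>P. \<not> dvd_visits k p W i \<omega>) :: real) = (\<Prod>p\<in>P. 1 - of_bool (dvd_visits k p W i \<omega>))"
      using P(1) by (induction P rule: finite_induct) auto
    also have "\<dots> = (\<Sum>X\<in>Pow P. (-1) ^ card X * (\<Prod>p\<in>X. of_bool (dvd_visits k p W i \<omega>)))"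
      using P(1) by (simp add: prod_diff_conv_sum)
    also have "\<dots> = (\<Sum>X\<in>Pow P. (-1) ^ card X * of_bool (dvd_visits k (\<Prod>X) W i \<omega>))"
    proof (intro sum.cong refl arg_cong2[where f = "(*)"])
      fix X assume "X \<in> Pow P"
      then have X: "finite X" "\<And>p. p \<in> X \<Longrightarrow> prime p" using P finite_subset by auto
      have "(\<Prod>p\<in>X. of_bool (dvd_visits k p W i \<omega>) :: real) = of_bool (\<forall>p\<in>X. dvd_visits k p W i \<omega>)"
        using X(1) by (induction X rule: finite_induct) auto
      also have "(\<forall>p\<in>X. dvd_visits k p W i \<omega>) \<longleftrightarrow> dvd_visits k (\<Prod>X) W i \<omega>"
        using prod_primes_dvd_iff[OF X] by (auto simp: dvd_visits_def)
      finally show "(\<Prod>p\<in>X. of_bool (dvd_visits k p W i \<omega>) :: real) = of_bool (dvd_visits k (\<Prod>X) W i \<omega>)" .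
    qed
    finally show ?thesis .
  qed
  then have "(\<Sum>i\<in>{1..n}. of_bool (\<forall>p\<in>P. \<not> dvd_visits k p W i \<omega>)) / real n
      = (\<Sum>i\<in>{1..n}. \<Sum>X\<in>Pow P. (-1) ^ card X * of_bool (dvd_visits k (\<Prod>X) W i \<omega>)) / real n" by simp
  also have "\<dots> = (\<Sum>X\<in>Pow P. (-1) ^ card X * dvd_freq k (\<Prod>X) W n \<omega>)"
    unfolding dvd_freq_def by (subst sum.swap) (simp add: sum_divide_distrib sum_distrib_left mult_ac)
  finally show ?thesis .
qed

text \<open>Visible positions survive the sieve. An invisible one survives only if a prime in
  \<open>{D<..n}\<close> divides all its coordinates, and summing over all \<open>d\<close> in that
  range counts it at least once.\<close>

lemma visible_freq_sieve_dist_le: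
  assumes sums: "\<And>i. (\<Sum>j<k. visits W i \<omega> j) = i"
  shows "\<bar>(\<Sum>i\<in>{1..n}. visX k W i \<omega>) / real n
      - (\<Sum>i\<in>{1..n}. of_bool (\<forall>p\<in>{p. prime p \<and> p \<le> D}. \<not> dvd_visits k p W i \<omega>)) / real n\<bar>
    \<le> (\<Sum>d\<in>{D<..n}. dvd_freq k d W n \<omega>)"
proof -
  define c where "c i = (of_bool (\<forall>p\<in>{p. prime p \<and> p \<le> D}. \<not> dvd_visits k p W i \<omega>) :: real)" for i
  have "\<bar>visX k W i \<omega> - c i\<bar> \<le> (\<Sum>d\<in>{D<..n}. of_bool (dvd_visits k d W i \<omega>))" if i: "i \<in> {1..n}" for i
  proof (cases "visible k (walk_pos W i \<omega>)")
    case True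
    then have "visX k W i \<omega> = c i"
      using visible_imp_not_dvd_visits[OF True] by (auto simp: visX_def c_def dest: prime_gt_1_nat)
    then show ?thesis by (simp add: sum_nonneg)
  next
    case False
    obtain p where p: "prime p" "p \<le> i" "dvd_visits k p W i \<omega>"
      using not_visible_imp_prime_dvd_visits[OF False sums] i by auto
    show ?thesis
    proof (cases "p \<le> D")
      case True
      then have "c i = 0" using p by (auto simp: c_def)
      then show ?thesis using False by (simp add: visX_def sum_nonneg)
    next
      case False
      then have "of_bool (dvd_visits k p W i \<omega>) \<le> (\<Sum>d\<in>{D<..n}. of_bool (dvd_visits k d W i \<omega>) :: real)"
        using p i by (intro member_le_sum) auto
      then show ?thesis using p \<open>\<not> visible k (walk_pos W i \<omega>)\<close> by (simp add: visX_def c_def)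
    qed
  qed
  then have "(\<Sum>i\<in>{1..n}. \<bar>visX k W i \<omega> - c i\<bar>)
      \<le> (\<Sum>i\<in>{1..n}. \<Sum>d\<in>{D<..n}. of_bool (dvd_visits k d W i \<omega>))"
    by (rule sum_mono)
  also have "\<dots> = (\<Sum>d\<in>{D<..n}. \<Sum>i\<in>{1..n}. of_bool (dvd_visits k d W i \<omega>))" by (rule sum.swap)
  finally have *: "(\<Sum>i\<in>{1..n}. \<bar>visX k W i \<omega> - c i\<bar>) / real n \<le> (\<Sum>d\<in>{D<..n}. dvd_freq k d W n \<omega>)"
    unfolding dvd_freq_def sum_divide_distrib[symmetric] by (rule divide_right_mono) simp
  have "\<bar>(\<Sum>i\<in>{1..n}. visX k W i \<omega>) / real n - (\<Sum>i\<in>{1..n}. c i) / real n\<bar>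
      = \<bar>\<Sum>i\<in>{1..n}. visX k W i \<omega> - c i\<bar> / real n"
    by (simp add: sum_subtractf flip: diff_divide_distrib)
  also have "\<dots> \<le> (\<Sum>i\<in>{1..n}. \<bar>visX k W i \<omega> - c i\<bar>) / real n"
    by (intro divide_right_mono sum_abs) simp
  also note *
  finally show ?thesis unfolding c_def .
qed

text \<open>As soon as \<open>m >= d\<close>, the deviation for \<open>d\<close> is a single term of
  the first sum in \<open>dvd_error\<close>.\<close>

lemma dvd_freq_tendsto:
  assumes err: "(\<lambda>m. dvd_error k W (Suc m) \<omega>) \<longlonglongrightarrow> 0" and d: "0 < d"
  shows "(\<lambda>m. dvd_freq k d W (Suc m ^ 32) \<omega>) \<longlonglongrightarrow> 1 / real d ^ k"
proof -
  have "eventually (\<lambda>m. \<bar>dvd_freq k d W (Suc m ^ 32) \<omega> - 1 / real d ^ k\<bar> \<le> dvd_error k W (Suc m) \<omega>) sequentially"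
    using eventually_ge_at_top[of d]
  proof eventually_elim
    case (elim m)
    have "d \<le> Suc m ^ 4" using elim self_le_power[of "Suc m" 4] by linarith
    then have "\<bar>dvd_freq k d W (Suc m ^ 32) \<omega> - 1 / real d ^ k\<bar>
        \<le> (\<Sum>d\<in>{1..Suc m ^ 4}. \<bar>dvd_freq k d W (Suc m ^ 32) \<omega> - 1 / real d ^ k\<bar>)"
      using d by (intro member_le_sum[where f = "\<lambda>d. \<bar>dvd_freq k d W (Suc m ^ 32) \<omega> - 1 / real d ^ k\<bar>"]) auto
    also have "\<dots> \<le> dvd_error k W (Suc m) \<omega>"
      unfolding dvd_error_def by (simp add: sum_nonneg dvd_freq_nonneg del: power_Suc)
    finally show ?case .
  qed
  then have "(\<lambda>m. dvd_freq k d W (Suc m ^ 32) \<omega> - 1 / real d ^ k) \<longlonglongrightarrow> 0"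
    by (intro Lim_null_comparison[OF _ err]) simp
  then show ?thesis by (rule LIM_zero_cancel)
qed

text \<open>Up to \<open>m^4\<close> each frequency is at most \<open>1 / d^k\<close> plus its
  deviation, and the main terms sum to at most the zeta tail. Beyond \<open>m^4\<close> the
  frequencies themselves are part of the error.\<close>

lemma large_dvd_freq_le:
  assumes k: "2 \<le> k"
  shows "(\<Sum>d\<in>{D<..m ^ 32}. dvd_freq k d W (m ^ 32) \<omega>)
    \<le> (\<Sum>\<^sub>\<infinity>n\<in>{D<..}. 1 / real n ^ k) + dvd_error k W m \<omega>"
proof -
  define a where "a d = dvd_freq k d W (m ^ 32) \<omega>" for d
  have a0: "0 \<le> a d" for d by (simp add: a_def dvd_freq_nonneg)
  have "(\<Sum>d\<in>{D<..m ^ 32}. a d) \<le> (\<Sum>d\<in>{D<..m ^ 4} \<union> {m ^ 4<..m ^ 32}. a d)"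
    by (intro sum_mono2) (auto simp: a0)
  also have "\<dots> = (\<Sum>d\<in>{D<..m ^ 4}. a d) + (\<Sum>d\<in>{m ^ 4<..m ^ 32}. a d)"
    by (intro sum.union_disjoint) auto
  also have "(\<Sum>d\<in>{D<..m ^ 4}. a d) \<le> (\<Sum>d\<in>{D<..m ^ 4}. 1 / real d ^ k + \<bar>a d - 1 / real d ^ k\<bar>)"
    by (intro sum_mono) linarith
  also have "\<dots> = (\<Sum>d\<in>{D<..m ^ 4}. 1 / real d ^ k) + (\<Sum>d\<in>{D<..m ^ 4}. \<bar>a d - 1 / real d ^ k\<bar>)"
    by (rule sum.distrib)
  also have "(\<Sum>d\<in>{D<..m ^ 4}. 1 / real d ^ k) \<le> (\<Sum>\<^sub>\<infinity>n\<in>{D<..}. 1 / real n ^ k)"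
    by (rule finite_sum_le_infsum) (auto intro: summable_on_inverse_power k)
  also have "(\<Sum>d\<in>{D<..m ^ 4}. \<bar>a d - 1 / real d ^ k\<bar>) \<le> (\<Sum>d\<in>{1..m ^ 4}. \<bar>a d - 1 / real d ^ k\<bar>)"
    by (intro sum_mono2) auto
  finally show ?thesis by (simp add: a_def dvd_error_def)
qed

text \<open>With \<open>D\<close> fixed first, four quarters of \<epsilon> add up: the zeta tail and
  the error from sieving only up to \<open>D\<close>, the convergence of the sieved frequency to
  \<open>Q\<close>, and the zeta tail again for the distance from \<open>Q\<close> to the
  limit.\<close>

lemma visible_freq_subseq_tendsto:
  assumes k: "2 \<le> k" and sums: "\<And>i. (\<Sum>j<k. visits W i \<omega> j) = i"
    and err: "(\<lambda>m. dvd_error k W (Suc m) \<omega>) \<longlonglongrightarrow> 0"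
  shows "(\<lambda>m. (\<Sum>i\<in>{1..Suc m ^ 32}. visX k W i \<omega>) / real (Suc m ^ 32)) \<longlonglongrightarrow> 1 / zeta_nat k"
proof (rule LIMSEQ_I)
  fix \<epsilon> :: real assume \<epsilon>: "0 < \<epsilon>"
  define v where "v n = (\<Sum>i\<in>{1..n}. visX k W i \<omega>) / real n" for n
  define \<tau> where "\<tau> D = (\<Sum>\<^sub>\<infinity>n\<in>{D<..}. 1 / real n ^ k)" for D :: nat
  have "eventually (\<lambda>D. \<tau> D < \<epsilon> / 4) sequentially"
    using infsum_greaterThan_tendsto_0[OF k] \<epsilon> unfolding \<tau>_def by (intro order_tendstoD) auto
  then obtain D where D: "\<tau> D < \<epsilon> / 4" by (auto simp: eventually_sequentially)
  define P where "P = {p::nat. prime p \<and> p \<le> D}"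
  have P: "finite P" "\<And>p. p \<in> P \<Longrightarrow> prime p"
    unfolding P_def by (auto intro: finite_subset[of _ "{..D}"])
  define s where "s n = (\<Sum>i\<in>{1..n}. of_bool (\<forall>p\<in>P. \<not> dvd_visits k p W i \<omega>)) / real n" for n
  have s_eq: "s n = (\<Sum>X\<in>Pow P. (-1) ^ card X * dvd_freq k (\<Prod>X) W n \<omega>)" for n
    unfolding s_def by (rule sieve_freq_eq[OF P])
  define Q where "Q = (\<Prod>p\<in>P. 1 - 1 / real p ^ k)"
  have "(\<lambda>m. s (Suc m ^ 32)) \<longlonglongrightarrow> (\<Sum>X\<in>Pow P. (-1) ^ card X * (1 / real (\<Prod>X) ^ k))"
    unfolding s_eq
  proof (intro tendsto_sum tendsto_mult tendsto_const dvd_freq_tendsto err)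
    fix X assume "X \<in> Pow P"
    then have "prime p" if "p \<in> X" for p using that P(2) by auto
    then show "0 < \<Prod>X" by (intro prod_pos) (simp add: prime_gt_0_nat)
  qed
  \<comment> \<open>The limits recombine because \<open>X\<close> to \<open>1 / (\<Prod>X)^k\<close>
    is multiplicative over the primes in \<open>X\<close>.\<close>
  also have "(\<Sum>X\<in>Pow P. (-1) ^ card X * (1 / real (\<Prod>X) ^ k)) = Q"
    using P(1) by (simp add: Q_def prod_diff_conv_sum prod_power_distrib prod_dividef)
  finally have "(\<lambda>m. s (Suc m ^ 32)) \<longlonglongrightarrow> Q" .
  then have ev1: "eventually (\<lambda>m. \<bar>s (Suc m ^ 32) - Q\<bar> < \<epsilon> / 4) sequentially"
    using \<epsilon> unfolding tendsto_iff dist_real_def by (auto elim!: allE[of _ "\<epsilon> / 4"])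
  have ev2: "eventually (\<lambda>m. dvd_error k W (Suc m) \<omega> < \<epsilon> / 4) sequentially"
    using err \<epsilon> by (intro order_tendstoD) auto
  have "\<bar>Q - 1 / zeta_nat k\<bar> \<le> \<tau> D"
    unfolding Q_def P_def \<tau>_def by (rule euler_product_dist_le[OF k])
  have "eventually (\<lambda>m. norm (v (Suc m ^ 32) - 1 / zeta_nat k) < \<epsilon>) sequentially"
    using ev1 ev2
  proof eventually_elim
    case (elim m)
    have "\<bar>v (Suc m ^ 32) - s (Suc m ^ 32)\<bar> \<le> (\<Sum>d\<in>{D<..Suc m ^ 32}. dvd_freq k d W (Suc m ^ 32) \<omega>)"
      unfolding v_def s_def P_def by (rule visible_freq_sieve_dist_le[OF sums])
    also have "\<dots> \<le> \<tau> D + dvd_error k W (Suc m) \<omega>"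
      unfolding \<tau>_def by (rule large_dvd_freq_le[OF k])
    finally show ?case
      using elim D \<open>\<bar>Q - 1 / zeta_nat k\<bar> \<le> \<tau> D\<close> unfolding real_norm_def by linarith
  qed
  then show "\<exists>no. \<forall>m\<ge>no. norm ((\<Sum>i\<in>{1..Suc m ^ 32}. visX k W i \<omega>) / real (Suc m ^ 32) - 1 / zeta_nat k) < \<epsilon>"
    unfolding v_def eventually_sequentially .
qed

text \<open>By monotonicity, for \<open>n\<close> between the \<open>r\<close>-th powers of
  \<open>m + 1\<close> and \<open>m + 2\<close> the average lies between \<open>t m / q m\<close>
  and \<open>t (m + 1) * q m\<close>, where the ratio \<open>q m\<close> of these powers tends to
  1.\<close>

lemma averages_tendsto_of_power_subseq:
  fixes s :: "nat \<Rightarrow> real" and r :: nat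
  assumes s: "incseq s" "\<And>n. 0 \<le> s n" and r: "0 < r"
    and lim: "(\<lambda>m. s (Suc m ^ r) / real (Suc m ^ r)) \<longlonglongrightarrow> L"
  shows "(\<lambda>n. s n / real n) \<longlonglongrightarrow> L"
proof (rule LIMSEQ_I)
  fix \<epsilon> :: real assume \<epsilon>: "0 < \<epsilon>"
  define t where "t m = s (Suc m ^ r) / real (Suc m ^ r)" for m
  define q where "q m = (real (Suc (Suc m)) / real (Suc m)) ^ r" for m
  have "(\<lambda>m. 1 + 1 / real (Suc m)) \<longlonglongrightarrow> 1 + 0"
    by (intro tendsto_add tendsto_const LIMSEQ_Suc lim_1_over_n)
  moreover have "1 + 1 / real (Suc m) = real (Suc (Suc m)) / real (Suc m)" for m
    by (simp add: field_simps)
  ultimately have "(\<lambda>m. real (Suc (Suc m)) / real (Suc m)) \<longlonglongrightarrow> 1" by simp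
  then have q: "q \<longlonglongrightarrow> 1" unfolding q_def[abs_def] using tendsto_power[of _ 1 _ r] by fastforce
  have "(\<lambda>m. t m / q m) \<longlonglongrightarrow> L / 1"
    using lim q unfolding t_def[abs_def, symmetric] by (intro tendsto_divide) auto
  then have e1: "eventually (\<lambda>m. L - \<epsilon> < t m / q m) sequentially"
    using \<epsilon> by (intro order_tendstoD) auto
  have "(\<lambda>m. t (Suc m) * q m) \<longlonglongrightarrow> L * 1"
    using lim q unfolding t_def[abs_def, symmetric] by (intro tendsto_mult LIMSEQ_Suc)
  then have e2: "eventually (\<lambda>m. t (Suc m) * q m < L + \<epsilon>) sequentially"
    using \<epsilon> by (intro order_tendstoD) auto
  obtain m0 where m0: "\<And>m. m \<ge> m0 \<Longrightarrow> L - \<epsilon> < t m / q m" "\<And>m. m \<ge> m0 \<Longrightarrow> t (Suc m) * q m < L + \<epsilon>"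
    using eventually_conj[OF e1 e2] unfolding eventually_sequentially by blast
  have "norm (s n / real n - L) < \<epsilon>" if n: "n \<ge> Suc m0 ^ r" for n
  proof -
    \<comment> \<open>Minimality puts \<open>n\<close> between consecutive \<open>r\<close>-th
      powers, and \<open>n >= Suc m0 ^ r\<close> forces \<open>x > Suc m0\<close>, so
      \<open>x\<close> has the form \<open>Suc (Suc m)\<close> with \<open>m >= m0\<close>.\<close>
    define x where "x = (LEAST x. n < x ^ r)"
    have "n < Suc n" by simp
    also have "Suc n \<le> Suc n ^ r" using r by (intro self_le_power) auto
    finally have "n < x ^ r" unfolding x_def by (rule LeastI)
    have "\<not> n < y ^ r" if "y < x" for y using not_less_Least[of y "\<lambda>x. n < x ^ r"] that x_def by simp
    moreover have xm: "Suc m0 < x"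
      using n \<open>n < x ^ r\<close> power_less_imp_less_base[of "Suc m0" r x] by linarith
    ultimately obtain m where m: "x = Suc (Suc m)" "Suc m ^ r \<le> n" "m0 \<le> m"
      by (metis Suc_le_D Suc_less_eq lessI less_Suc_eq_le less_imp_Suc_add not_less)
    have n0: "0 < real n" using m(2) by (metis gr0I le_zero_eq of_nat_0_less_iff power_eq_0_iff Zero_not_Suc)
    have le1: "real (Suc m ^ r) \<le> real n" using m(2) by (simp only: of_nat_le_iff)
    have le2: "real n \<le> real (Suc (Suc m) ^ r)" using \<open>n < x ^ r\<close> m(1) by (simp only: of_nat_le_iff) 
    have pos: "0 < real (Suc m ^ r)" "0 < real (Suc (Suc m) ^ r)" by (simp_all only: of_nat_0_less_iff zero_less_power zero_less_Suc)
    have q_eq: "q m = real (Suc (Suc m) ^ r) / real (Suc m ^ r)"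
      by (simp only: q_def power_divide of_nat_power)
    have "t m / q m = s (Suc m ^ r) / real (Suc (Suc m) ^ r)"
      unfolding t_def q_eq using pos by (simp del: of_nat_power of_nat_Suc)
    also have "\<dots> \<le> s n / real n"
      using le2 n0 m(2) s by (intro frac_le) (auto dest: incseqD)
    finally have low: "L - \<epsilon> < s n / real n" using m0(1)[OF m(3)] by linarith
    have "s n / real n \<le> s (Suc (Suc m) ^ r) / real (Suc m ^ r)"
      using le1 le2 pos s by (intro frac_le incseqD[OF s(1)]) (auto simp only: of_nat_le_iff)
    also have "\<dots> = t (Suc m) * q m"
      unfolding t_def q_eq using pos by (simp del: of_nat_power of_nat_Suc)
    finally have "s n / real n < L + \<epsilon>" using m0(2)[OF m(3)] by linarith
    with low show ?thesis by (simp add: abs_less_iff)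
  qed
  then show "\<exists>no. \<forall>n\<ge>no. norm (s n / real n - L) < \<epsilon>" by blast
qed

lemma (in lattice_walk) AE_visible_freq_tendsto:
  "AE \<omega> in M. (\<lambda>n. (\<Sum>i\<in>{1..n}. visX k W i \<omega>) / real n) \<longlonglongrightarrow> 1 / zeta_nat k"
  using AE_visits_sum AE_dvd_error_tendsto
proof eventually_elim
  case (elim \<omega>)
  show ?case
  proof (rule averages_tendsto_of_power_subseq)
    show "incseq (\<lambda>n. \<Sum>i\<in>{1..n}. visX k W i \<omega>)"
      by (intro incseq_SucI) (simp add: visX_def)
    show "(\<lambda>m. (\<Sum>i\<in>{1..Suc m ^ 32}. visX k W i \<omega>) / real (Suc m ^ 32)) \<longlonglongrightarrow> 1 / zeta_nat k"
      using elim k_ge_2 by (intro visible_freq_subseq_tendsto) auto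
  qed (auto simp: visX_def sum_nonneg)
qed

theorem theorem1p1:
  fixes M :: "'a measure" and k q :: nat
    and \<alpha> :: "nat \<Rightarrow> nat \<Rightarrow> real"  \<comment> \<open>\<alpha> t j = j-th entry of type vector t, t < q, j < k\<close>
    and c :: "nat \<Rightarrow> nat"  \<comment> \<open>index of the type chosen at step i\<close>
    and W :: "nat \<Rightarrow> 'a \<Rightarrow> nat"  \<comment> \<open>W i = index j of the basis vector taken at step i\<close>
  assumes "prob_space M"
    and "k \<ge> 2" and "q \<ge> 1"
    and "\<And>t j. t < q \<Longrightarrow> j < k \<Longrightarrow> 0 < \<alpha> t j \<and> \<alpha> t j < 1"
    and "\<And>t. t < q \<Longrightarrow> (\<Sum>j<k. \<alpha> t j) = 1"
    and "\<And>i. i \<ge> 1 \<Longrightarrow> c i < q"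
    and "prob_space.indep_vars M (\<lambda>_. count_space UNIV) W {1..}"
    and "\<And>i j. i \<ge> 1 \<Longrightarrow> j < k \<Longrightarrow> measure M {\<omega> \<in> space M. W i \<omega> = j} = \<alpha> (c i) j"
  shows "AE \<omega> in M. (\<lambda>n. (1 / real n) * (\<Sum>i=1..n. visX k W i \<omega>))
            \<longlonglongrightarrow> 1 / zeta_nat k"
proof -
  \<comment> \<open>There are finitely many types with positive entries, so the smallest entry is
    positive and bounds the step probabilities at all times.\<close>
  define \<delta> where "\<delta> = Min ((\<lambda>(t, j). \<alpha> t j) ` ({..<q} \<times> {..<k}))"
  have ne: "(0, 0) \<in> {..<q} \<times> {..<k}" using assms(2,3) by auto
  have "\<delta> \<in> (\<lambda>(t, j). \<alpha> t j) ` ({..<q} \<times> {..<k})"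
    unfolding \<delta>_def using ne by (intro Min_in) auto
  then have \<delta>_pos: "0 < \<delta>" using assms(4) by auto
  have \<delta>_le: "\<delta> \<le> \<alpha> t j" if "t < q" "j < k" for t j
    unfolding \<delta>_def using that by (intro Min_le) auto
  interpret prob_space M by (rule assms(1))
  interpret lattice_walk M k W \<delta>
    by unfold_locales (use assms \<delta>_pos \<delta>_le in auto)
  show ?thesis using AE_visible_freq_tendsto by simp
qed

end
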